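(* Let $\mathcal{R}_0$ be the Riccati operator described in the context. The feedback controller $$U(t)=-\sum_{j=1}^N(B_1\varphi_j^*,\mathcal{R}_0(u-u_e))\varphi_j^*$$ exponentially stabilizes the system $$\frac{du}{dt}+\nu Au+B(u)=f+B_1U,\qquad u(0)=u^0,$$ to the solution $u_e$ of the steady state equation $\nu Au_e+B(u_e)=f$ in a neighbourhood $$\mathcal{X}=\{u^0\in H:\ |u^0-u_e|<\rho\}$$ of $u_e$, for some $\rho>0$. Moreover, if $\rho$ is sufficiently small, then for each $u^0\in\mathcal{X}$ the solution $u\in C([0,T);H)\cap L^2(0,T;V)$ of the corresponding closed loop system $$\frac{du}{dt}+\nu Au+B(u)+\sum_{j=1}^N(B_1\varphi_j^*,\mathcal{R}_0(u-u_e))B_1\varphi_j^*=f,\qquad u(0)=u^0,$$ satisfies $$\int_0^Te^{2\beta t}|A^{1/2}(u(t)-u_e)|^2\,dt\le C|u^0-u_e|^2\qquad\text{and}\qquad|u(t)-u_e|\le Ce^{-\beta t}|u^0-u_e|,$$ where $C>0$ is a constant independent of $u^0$.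
   Context: $H=\ell^2(\mathbb{C})$ (complex sequences indexed by $n\ge 1$) with $(u,v)=\sum_{n\ge1}u_nv_n^*$ and $|u|=(u,u)^{1/2}$. Fix $\lambda>1$, $k_0>0$, $k_n=k_0\lambda^n$, $\nu>0$, and constants $a,b,c$ with $a+b+c=0$. Let $(\phi_n)$ be the canonical basis of $H$. $A\phi_n=k_n^2\phi_n$, with $D(A)=\{u\in H:|Au|<\infty\}$; $A^su=(k_n^{2s}u_n)_n$. $V=D(A^{1/2})$ with norm $\|u\|=|A^{1/2}u|$, $V'=D(A^{-1/2})$ its dual, duality $\langle\cdot,\cdot\rangle$ extending $(\cdot,\cdot)$. The map $B$ is $$B(u,v)=-i\sum_{n=1}^\infty\big(ak_{n+1}v_{n+2}u_{n+1}^*+bk_nv_{n+1}u_{n-1}^*+ak_{n-1}u_{n-1}v_{n-2}+bk_{n-1}v_{n-1}u_{n-2}\big)\phi_n,$$ with $u_0=u_{-1}=v_0=v_{-1}=0$ (in these component formulas $^*$ is complex conjugation), and $B(u)=B(u,u)$. $f$ is a time-independent forcing, $u_e$ a solution of $\nu Au_e+B(u_e)=f$, and $T>0$. The linearized operator is $\mathcal{A}u=\nu Au+B(u,u_e)+B(u_e,u)$ with $D(\mathcal{A})=D(A)$; it has compact resolvent. $B_1\in\mathcal{L}(H,H)$. The spectrum of $\mathcal{A}$ is taken to be semisimple with distinct eigenvalues $\lambda_j$, and $\{\varphi_j\}$, $\{\varphi_j^*\}$ are corresponding eigenvectors of $\mathcal{A}$ and its adjoint $\mathcal{A}^*$, i.e.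 $\mathcal{A}\varphi_j=\lambda_j\varphi_j$, $\mathcal{A}^*\varphi_j^*=\bar\lambda_j\varphi_j^*$, biorthogonal: $\langle\varphi_j,\varphi_i^*\rangle=\delta_{ij}$. Given $\beta>0$, $N$ is such that $\mathrm{Re}\,\lambda_1\le\cdots\le\mathrm{Re}\,\lambda_N<\beta<\mathrm{Re}\,\lambda_{N+1}\le\cdots$. $\mathcal{R}_0:D(\mathcal{R}_0)\subset H\to H$ is a linear self-adjoint operator, $\mathcal{R}_0\ge0$, such that $b_1|u|^2\le(\mathcal{R}_0u,u)\le b_2|u|^2$ for all $u\in H$ and some constants $b_1,b_2>0$; $|\mathcal{R}_0u|\le C\|u\|$ for all $u\in V$; and $$(\mathcal{A}u-\beta u,\mathcal{R}_0u)+\frac12\sum_{j=1}^N(B_1\varphi_j^*,\mathcal{R}_0u)^2=\frac12|A^{1/2}u|^2,\qquad u\in D(A).$$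
   Formalization: In the Riccati equation the first product is replaced by its real part and the squares of (B_1φ_j^*,R_0u) by squared moduli; the feedback coefficients are (R_0(u-u_e),B_1φ_j^* ), in reversed order; adjoint and self-adjoint refer to Re(u,v). As printed, complex squares are inconsistent for N≥1. *)

theory Defs
  imports "HOL-Analysis.Analysis"
begin

section \<open>The Hilbert space of square summable complex sequences\<close>

text \<open>The sequences are indexed by $n \ge 1$; they are represented on all of \<^typ>\<open>nat\<close>
  with value 0 at the index 0.\<close>

definition square_summable :: "(nat \<Rightarrow> complex) set" where
  "square_summable = {x. x 0 = 0 \<and> summable (\<lambda>n. (cmod (x n))\<^sup>2)}"

typedef ell2 = square_summable
  morphisms coord Ell2
  by (rule exI[of _ "\<lambda>_. 0"]) (simp add: square_summable_def)

lemma square_summable_add: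
  assumes "x \<in> square_summable" "y \<in> square_summable"
  shows "(\<lambda>n. x n + y n) \<in> square_summable"
proof -
  have x: "x 0 = 0" "summable (\<lambda>n. (cmod (x n))\<^sup>2)"
    and y: "y 0 = 0" "summable (\<lambda>n. (cmod (y n))\<^sup>2)"
    using assms unfolding square_summable_def by blast+
  have "summable (\<lambda>n. (cmod (x n + y n))\<^sup>2)"
  proof (rule summable_comparison_test')
    show "summable (\<lambda>n. 2 * ((cmod (x n))\<^sup>2 + (cmod (y n))\<^sup>2))"
      by (rule summable_mult[OF summable_add[OF x(2) y(2)]])
    show "norm ((cmod (x n + y n))\<^sup>2) \<le> 2 * ((cmod (x n))\<^sup>2 + (cmod (y n))\<^sup>2)" if "n \<ge> 0" for n
    proof -
      have "(cmod (x n + y n))\<^sup>2 \<le> (cmod (x n) + cmod (y n))\<^sup>2"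
        by (rule power_mono[OF norm_triangle_ineq norm_ge_zero])
      also have "\<dots> \<le> 2 * ((cmod (x n))\<^sup>2 + (cmod (y n))\<^sup>2)"
        unfolding power2_sum mult_2 by (rule add_left_mono[OF sum_squares_bound[unfolded mult_2]])
      finally have "(cmod (x n + y n))\<^sup>2 \<le> 2 * ((cmod (x n))\<^sup>2 + (cmod (y n))\<^sup>2)" .
      then show ?thesis
        unfolding real_norm_def abs_power2 .
    qed
  qed
  then show ?thesis
    unfolding square_summable_def mem_Collect_eq x(1) y(1) add_0_left by blast
qed

lemma square_summable_mult:
  assumes "x \<in> square_summable"
  shows "(\<lambda>n. c * x n) \<in> square_summable"
proof -
  have x: "x 0 = 0" "summable (\<lambda>n. (cmod (x n))\<^sup>2)"
    using assms unfolding square_summable_def by blast+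
  have "summable (\<lambda>n. (cmod (c * x n))\<^sup>2)"
    unfolding norm_mult power_mult_distrib by (rule summable_mult[OF x(2)])
  then show ?thesis
    unfolding square_summable_def mem_Collect_eq x(1) mult_zero_right by blast
qed

lemma summable_coord_square: "summable (\<lambda>n. (cmod (coord u n))\<^sup>2)"
  using coord[of u] unfolding square_summable_def by blast

lemma summable_coord_mult_cnj: "summable (\<lambda>n. coord u n * cnj (coord v n))"
proof (rule summable_comparison_test')
  show "summable (\<lambda>n. (cmod (coord u n))\<^sup>2 + (cmod (coord v n))\<^sup>2)"
    by (intro summable_add summable_coord_square)
  show "norm (coord u n * cnj (coord v n)) \<le> (cmod (coord u n))\<^sup>2 + (cmod (coord v n))\<^sup>2"
    if "n \<ge> 0" for n
  proof -
    have "2 * cmod (coord u n) * cmod (coord v n) \<le> (cmod (coord u n))\<^sup>2 + (cmod (coord v n))\<^sup>2"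
      by (rule sum_squares_bound)
    moreover have "0 \<le> cmod (coord u n) * cmod (coord v n)"
      by (intro mult_nonneg_nonneg norm_ge_zero)
    ultimately have "cmod (coord u n) * cmod (coord v n) \<le> (cmod (coord u n))\<^sup>2 + (cmod (coord v n))\<^sup>2"
      unfolding mult.assoc by linarith
    then show ?thesis by (simp only: norm_mult complex_mod_cnj)
  qed
qed

definition cinner :: "ell2 \<Rightarrow> ell2 \<Rightarrow> complex" where
  "cinner u v = (\<Sum>n. coord u n * cnj (coord v n))"

definition cscale :: "complex \<Rightarrow> ell2 \<Rightarrow> ell2"  (infixr "*\<^sub>C" 75) where
  "c *\<^sub>C u = Ell2 (\<lambda>n. c * coord u n)"

text \<open>The instance makes \<^typ>\<open>ell2\<close> a real inner product space, with inner product
  $\mathrm{Re}\,(u,v)$; its norm is the norm of the complex Hilbert space.\<close>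

instantiation ell2 :: real_inner
begin

definition "0 = Ell2 (\<lambda>_. 0)"
definition "u + v = Ell2 (\<lambda>n. coord u n + coord v n)"
definition "- u = Ell2 (\<lambda>n. - coord u n)"
definition "u - v = Ell2 (\<lambda>n. coord u n - coord v n)"
definition "r *\<^sub>R u = Ell2 (\<lambda>n. of_real r * coord u n)"
definition "u \<bullet> v = Re (cinner u v)"
definition "norm u = sqrt (u \<bullet> u)" for u :: ell2
definition "sgn u = inverse (norm u) *\<^sub>R u" for u :: ell2
definition "dist u v = norm (u - v)" for u v :: ell2
definition "uniformity = (INF e\<in>{0<..}. principal {(x, y :: ell2). dist x y < e})"
definition "open U \<longleftrightarrow> (\<forall>x\<in>U. \<forall>\<^sub>F (x', y) in uniformity. x' = x \<longrightarrow> y \<in> U)" for U :: "ell2 set"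

lemma coord_zero [simp]: "coord 0 = (\<lambda>_. 0)"
  by (simp add: zero_ell2_def Ell2_inverse square_summable_def)

lemma coord_add [simp]: "coord (u + v) = (\<lambda>n. coord u n + coord v n)"
  unfolding plus_ell2_def by (rule Ell2_inverse[OF square_summable_add[OF coord coord]])

lemma coord_uminus [simp]: "coord (- u) = (\<lambda>n. - coord u n)"
  unfolding uminus_ell2_def
  by (rule Ell2_inverse[OF square_summable_mult[OF coord, of "-1", unfolded mult_minus1]])

lemma coord_diff [simp]: "coord (u - v) = (\<lambda>n. coord u n - coord v n)"
  unfolding minus_ell2_def
  by (rule Ell2_inverse[OF square_summable_add[OF coord coord, of u "- v",
        unfolded coord_uminus add_uminus_conv_diff]])

lemma coord_scaleR [simp]: "coord (r *\<^sub>R u) = (\<lambda>n. of_real r * coord u n)"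
  unfolding scaleR_ell2_def by (rule Ell2_inverse[OF square_summable_mult[OF coord]])

instance
proof
  fix u v w :: ell2 and r s :: real
  have eqI: "x = y" if "\<And>n. coord x n = coord y n" for x y
    using that coord_inject[of x y] by blast
  show "u + v + w = u + (v + w)" by (rule eqI) (simp add: add.assoc)
  show "u + v = v + u" by (rule eqI) (simp add: add.commute)
  show "0 + u = u" by (rule eqI) simp
  show "- u + u = 0" by (rule eqI) simp
  show "u - v = u + - v" by (rule eqI) simp
  show "r *\<^sub>R (u + v) = r *\<^sub>R u + r *\<^sub>R v" by (rule eqI) (simp add: distrib_left)
  show "(r + s) *\<^sub>R u = r *\<^sub>R u + s *\<^sub>R u" by (rule eqI) (simp add: distrib_right)
  show "r *\<^sub>R s *\<^sub>R u = (r * s) *\<^sub>R u" by (rule eqI) simp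
  show "1 *\<^sub>R u = u" by (rule eqI) simp
  show "u \<bullet> v = v \<bullet> u"
  proof -
    have "(\<lambda>n. cnj (coord u n * cnj (coord v n))) sums cnj (cinner u v)"
      unfolding sums_cnj cinner_def by (rule summable_sums[OF summable_coord_mult_cnj])
    then have "(\<lambda>n. coord v n * cnj (coord u n)) sums cnj (cinner u v)"
      by (simp only: complex_cnj_mult complex_cnj_cnj mult.commute)
    then have "cinner v u = cnj (cinner u v)"
      unfolding cinner_def by (simp only: sums_iff)
    then show ?thesis by (simp add: inner_ell2_def)
  qed
  have "cinner (u + v) w = cinner u w + cinner v w"
    unfolding cinner_def coord_add distrib_right
    by (rule suminf_add[symmetric]) (rule summable_coord_mult_cnj)+
  then show "(u + v) \<bullet> w = u \<bullet> w + v \<bullet> w"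
    by (simp add: inner_ell2_def)
  have "cinner (r *\<^sub>R u) v = of_real r * cinner u v"
    unfolding cinner_def coord_scaleR mult.assoc by (rule suminf_mult[OF summable_coord_mult_cnj])
  then show "(r *\<^sub>R u) \<bullet> v = r * (u \<bullet> v)"
    by (simp add: inner_ell2_def)
  note s = summable_coord_square[of u]
  have "cinner u u = (\<Sum>n. complex_of_real ((cmod (coord u n))\<^sup>2))"
    by (simp only: cinner_def complex_norm_square)
  also have "\<dots> = complex_of_real (\<Sum>n. (cmod (coord u n))\<^sup>2)"
    by (rule suminf_of_real[OF s, symmetric])
  finally have *: "u \<bullet> u = (\<Sum>n. (cmod (coord u n))\<^sup>2)"
    by (simp only: inner_ell2_def Re_complex_of_real)
  show "0 \<le> u \<bullet> u"
    unfolding * by (rule suminf_nonneg[OF s]) simp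
  show "u \<bullet> u = 0 \<longleftrightarrow> u = 0"
    unfolding * by (subst suminf_eq_zero_iff[OF s]) (auto intro: eqI)
qed (rule norm_ell2_def sgn_ell2_def dist_ell2_def uniformity_ell2_def open_ell2_def)+

end


section \<open>Operators on the Hilbert space\<close>

text \<open>The bilinear map of the shell model is linear in some of the components and conjugate linear
  in others, so its linearization about a steady state is in general only real linear on the complex
  space. Hence adjoints and selfadjointness refer to the inner product $\mathrm{Re}\,(u,v)$. For
  complex linear operators this is equivalent to using $(u,v)$ itself, since
  $\mathrm{Im}\,(u,v) = -\mathrm{Re}\,(iu,v)$.\<close>

definition adjoint_at :: "ell2 set \<Rightarrow> (ell2 \<Rightarrow> ell2) \<Rightarrow> ell2 \<Rightarrow> ell2 \<Rightarrow> bool" where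
  \<comment> \<open>\<open>v\<close> lies in the domain of the adjoint of \<open>T\<close> (with domain \<open>D\<close>), and is mapped to \<open>w\<close>\<close>
  "adjoint_at D T v w \<longleftrightarrow> (\<forall>u\<in>D. T u \<bullet> v = u \<bullet> w)"

definition self_adjoint_operator :: "ell2 set \<Rightarrow> (ell2 \<Rightarrow> ell2) \<Rightarrow> bool" where
  "self_adjoint_operator D T \<longleftrightarrow>
     subspace D \<and> closure D = UNIV \<and>
     (\<forall>u\<in>D. \<forall>v\<in>D. T (u + v) = T u + T v) \<and> (\<forall>r. \<forall>u\<in>D. T (r *\<^sub>R u) = r *\<^sub>R T u) \<and>
     (\<forall>v w. adjoint_at D T v w \<longleftrightarrow> v \<in> D \<and> w = T v)"

definition op_spectrum :: "ell2 set \<Rightarrow> (ell2 \<Rightarrow> ell2) \<Rightarrow> complex set" where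
  "op_spectrum D T = - {\<mu>. bij_betw (\<lambda>u. T u - \<mu> *\<^sub>C u) D UNIV \<and>
                          (\<exists>M. \<forall>u\<in>D. norm u \<le> M * norm (T u - \<mu> *\<^sub>C u))}"

definition semisimple_eigenvalue :: "ell2 set \<Rightarrow> (ell2 \<Rightarrow> ell2) \<Rightarrow> complex \<Rightarrow> bool" where
  "semisimple_eigenvalue D T \<mu> \<longleftrightarrow>
     (\<exists>u\<in>D. u \<noteq> 0 \<and> T u = \<mu> *\<^sub>C u) \<and>
     (\<forall>u\<in>D. T u - \<mu> *\<^sub>C u \<in> D \<longrightarrow>
        T (T u - \<mu> *\<^sub>C u) - \<mu> *\<^sub>C (T u - \<mu> *\<^sub>C u) = 0 \<longrightarrow> T u - \<mu> *\<^sub>C u = 0)"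


section \<open>The shell model\<close>

text \<open>Elements of $V'$ are sequences that need not be square summable, so they are represented by
  functions \<^typ>\<open>nat \<Rightarrow> complex\<close>, as are the values of the extensions of \<open>A\<close> and \<open>B\<close> to
  $V \to V'$ and $H \times H \to V'$. The argument \<open>k\<close> is the sequence of wave numbers.\<close>

definition A_pow_seq :: "(nat \<Rightarrow> real) \<Rightarrow> real \<Rightarrow> ell2 \<Rightarrow> nat \<Rightarrow> complex" where
  "A_pow_seq k s u n = of_real (k n powr (2 * s)) * coord u n"

definition dom_A_pow :: "(nat \<Rightarrow> real) \<Rightarrow> real \<Rightarrow> ell2 set" where
  "dom_A_pow k s = {u. A_pow_seq k s u \<in> square_summable}"

definition A_pow :: "(nat \<Rightarrow> real) \<Rightarrow> real \<Rightarrow> ell2 \<Rightarrow> ell2" where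
  \<comment> \<open>only meaningful on \<open>dom_A_pow k s\<close>\<close>
  "A_pow k s u = Ell2 (A_pow_seq k s u)"

definition V_space :: "(nat \<Rightarrow> real) \<Rightarrow> ell2 set" where
  "V_space k = dom_A_pow k (1/2)"

definition V_norm :: "(nat \<Rightarrow> real) \<Rightarrow> ell2 \<Rightarrow> real" where
  "V_norm k u = norm (A_pow k (1/2) u)"

definition V_dual :: "(nat \<Rightarrow> real) \<Rightarrow> (nat \<Rightarrow> complex) set" where
  "V_dual k = {g. (\<lambda>n. of_real (k n powr (-1)) * g n) \<in> square_summable}"

definition duality :: "(nat \<Rightarrow> complex) \<Rightarrow> ell2 \<Rightarrow> complex" where
  "duality g v = (\<Sum>n. g n * cnj (coord v n))"

text \<open>Since natural subtraction truncates and \<open>coord u 0 = 0\<close>, the conventions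
  $u_0 = u_{-1} = 0$ are built in.\<close>

definition B_seq :: "(nat \<Rightarrow> real) \<Rightarrow> real \<Rightarrow> real \<Rightarrow> ell2 \<Rightarrow> ell2 \<Rightarrow> nat \<Rightarrow> complex" where
  "B_seq k a b u v n =
     (if n = 0 then 0 else
      - \<i> * (of_real (a * k (n + 1)) * coord v (n + 2) * cnj (coord u (n + 1))
            + of_real (b * k n) * coord v (n + 1) * cnj (coord u (n - 1))
            + of_real (a * k (n - 1)) * coord u (n - 1) * coord v (n - 2)
            + of_real (b * k (n - 1)) * coord v (n - 1) * coord u (n - 2)))"

definition lin_op :: "(nat \<Rightarrow> real) \<Rightarrow> real \<Rightarrow> real \<Rightarrow> real \<Rightarrow> ell2 \<Rightarrow> ell2 \<Rightarrow> ell2" where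
  \<comment> \<open>only meaningful on \<open>dom_A_pow k 1\<close>\<close>
  "lin_op k \<nu> a b ue u =
     Ell2 (\<lambda>n. of_real \<nu> * A_pow_seq k 1 u n + B_seq k a b u ue n + B_seq k a b ue u n)"

text \<open>\<open>weak_solution k \<nu> a b G u0 T u\<close>: on $[0,T)$ the function \<open>u\<close> is in
  $C([0,T);H) \cap L^2(0,T;V)$ and solves $u' + \nu Au + B(u) = G(u)$, $u(0) = u^0$ in $V'$, where
  \<open>G\<close> takes values in $V'$. The equation is integrated in time and tested with the elements of
  \<open>V\<close>. Measurability of \<open>u\<close> into \<open>V\<close> follows from continuity into \<open>H\<close>.\<close>

definition weak_solution ::
  "(nat \<Rightarrow> real) \<Rightarrow> real \<Rightarrow> real \<Rightarrow> real \<Rightarrow> (ell2 \<Rightarrow> nat \<Rightarrow> complex) \<Rightarrow> ell2 \<Rightarrow> real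
    \<Rightarrow> (real \<Rightarrow> ell2) \<Rightarrow> bool" where
  "weak_solution k \<nu> a b G u0 T u \<longleftrightarrow>
     continuous_on {0..<T} u \<and> u 0 = u0 \<and>
     (AE t in lebesgue. t \<in> {0<..<T} \<longrightarrow> u t \<in> V_space k) \<and>
     (\<integral>\<^sup>+t\<in>{0<..<T}. ennreal ((V_norm k (u t))\<^sup>2) \<partial>lebesgue) < \<infinity> \<and>
     (\<forall>v\<in>V_space k. \<forall>t\<in>{0..<T}.
        let g = (\<lambda>s. duality (\<lambda>n. G (u s) n - of_real \<nu> * A_pow_seq k 1 (u s) n
                                    - B_seq k a b (u s) (u s) n) v)
        in set_integrable lebesgue {0..t} g \<and>
           cinner (u t) v = cinner u0 v + (LINT s:{0..t}|lebesgue. g s))"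

text \<open>The state feedback $U = K(u)$ exponentially stabilizes $u' + \nu Au + B(u) = f + B_1U$ to \<open>ue\<close>
  in the ball of radius \<open>\<rho>\<close>: from every initial state in the ball there starts a solution on
  $[0,\infty)$, and all solutions that start there decay exponentially to \<open>ue\<close>.\<close>

definition exponentially_stabilizes ::
  "(nat \<Rightarrow> real) \<Rightarrow> real \<Rightarrow> real \<Rightarrow> real \<Rightarrow> (nat \<Rightarrow> complex) \<Rightarrow> (ell2 \<Rightarrow> ell2)
    \<Rightarrow> (ell2 \<Rightarrow> ell2) \<Rightarrow> ell2 \<Rightarrow> real \<Rightarrow> bool" where
  "exponentially_stabilizes k \<nu> a b f B1 K ue \<rho> \<longleftrightarrow>
     (\<exists>M>0. \<exists>\<gamma>>0. \<forall>u0\<in>ball ue \<rho>.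
        let G = (\<lambda>x n. f n + coord (B1 (K x)) n) in
        (\<exists>u. \<forall>T>0. weak_solution k \<nu> a b G u0 T u) \<and>
        (\<forall>T>0. \<forall>u. weak_solution k \<nu> a b G u0 T u \<longrightarrow>
           (\<forall>t\<in>{0..<T}. norm (u t - ue) \<le> M * exp (- \<gamma> * t) * norm (u0 - ue))))"

text \<open>The coefficients are the inner products of $\mathcal{R}_0(u-u_e)$ with the actuators
  $B_1\varphi_j^*$, in the order of arguments that is linear in $\mathcal{R}_0(u-u_e)$.\<close>

definition riccati_feedback ::
  "nat \<Rightarrow> (ell2 \<Rightarrow> ell2) \<Rightarrow> (nat \<Rightarrow> ell2) \<Rightarrow> (ell2 \<Rightarrow> ell2) \<Rightarrow> ell2 \<Rightarrow> ell2 \<Rightarrow> ell2" where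
  "riccati_feedback N B1 \<phi>s R0 ue u =
     - (\<Sum>j=1..N. cinner (R0 (u - ue)) (B1 (\<phi>s j)) *\<^sub>C \<phi>s j)"

definition closed_loop_term ::
  "nat \<Rightarrow> (ell2 \<Rightarrow> ell2) \<Rightarrow> (nat \<Rightarrow> ell2) \<Rightarrow> (ell2 \<Rightarrow> ell2) \<Rightarrow> ell2 \<Rightarrow> ell2 \<Rightarrow> ell2" where
  "closed_loop_term N B1 \<phi>s R0 ue u =
     (\<Sum>j=1..N. cinner (R0 (u - ue)) (B1 (\<phi>s j)) *\<^sub>C B1 (\<phi>s j))"

text \<open>The Riccati equation of the linear quadratic problem with complex controls on the complex space:
  the first term is a real part (\<open>\<bullet>\<close> is $\mathrm{Re}\,(\cdot,\cdot)$), and the square of a complex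
  coefficient is the square of its modulus, so that both sides are real.\<close>

definition riccati_equation ::
  "(nat \<Rightarrow> real) \<Rightarrow> (ell2 \<Rightarrow> ell2) \<Rightarrow> real \<Rightarrow> nat \<Rightarrow> (ell2 \<Rightarrow> ell2) \<Rightarrow> (nat \<Rightarrow> ell2) \<Rightarrow> (ell2 \<Rightarrow> ell2) \<Rightarrow> bool"
  where
  "riccati_equation k L \<beta> N B1 \<phi>s R0 \<longleftrightarrow>
     (\<forall>u\<in>dom_A_pow k 1.
        (L u - \<beta> *\<^sub>R u) \<bullet> R0 u + 1/2 * (\<Sum>j=1..N. (cmod (cinner (B1 (\<phi>s j)) (R0 u)))\<^sup>2)
          = 1/2 * (norm (A_pow k (1/2) u))\<^sup>2)"

end

theory Submission
  imports Defs
begin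

text \<open>The deviation \<open>w = u - ue\<close> solves \<open>w' + \<nu> A w + S w + B(w,w) = 0\<close>, where \<open>S\<close> collects the
  linearization of \<open>B\<close> about \<open>ue\<close> and the feedback. Since \<open>ue\<close> lies in \<open>V\<close> and the hypotheses force
  \<open>R0\<close> to be bounded, \<open>S\<close> is a bounded operator on \<open>H\<close> (\<open>bounded_linear_drift\<close>).

  The quadratic form \<open>(R0 w, w)\<close> is a Lyapunov function. By the Riccati equation and the choice of the
  feedback, its derivative is at most \<open>- 2 \<beta> (R0 w, w) - |A\<^sup>1\<^sup>/\<^sup>2 w|\<^sup>2 - 2 (B(w,w), R0 w)\<close>
  (\<open>riccati_dissipation\<close>). In the shell model \<open>|B(w,w)| \<le> C |w| |A\<^sup>1\<^sup>/\<^sup>2 w|\<close>, so for small \<open>|w|\<close> the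
  last term is at most half of the dissipation. Integration gives
  \<open>e\<^sup>2\<^sup>\<beta>\<^sup>t (R0 w(t), w(t)) + 1/2 \<integral> e\<^sup>2\<^sup>\<beta>\<^sup>s |A\<^sup>1\<^sup>/\<^sup>2 w|\<^sup>2 ds \<le> (R0 w(0), w(0))\<close>, which contains both claimed
  estimates.

  The Riccati equation holds on \<open>D(A)\<close> only, while a weak solution takes values in \<open>V\<close>. The Lyapunov
  function is therefore evaluated at the truncations \<open>P\<^sub>m w\<close> to the first coordinates. They commute
  with \<open>A\<close>, so the error is the commutator of \<open>P\<^sub>m\<close> with \<open>S\<close>, which is bounded on \<open>H\<close> and tends to 0
  (\<open>residual_tendsto\<close>); the limit is taken in \<open>lyapunov_estimate\<close>.

  For existence, the argument of the quadratic term is replaced by its radial projection to a small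
  ball (\<open>clip\<close>). Then the equation has a globally Lipschitz
  nonlinearity with values in the dual of \<open>V\<close>; a weighted contraction, based on nothing but the
  energy estimate of each coordinate equation, solves it for all times
  (\<open>semilinear_solution_exists\<close>) and uniquely (\<open>semilinear_solution_unique\<close>). The Lyapunov estimate
  holds for every solution of the clipped equation. It shows that a solution with a small
  initial value never leaves the ball, so that the clipping is inactive. Conversely, every weak solution
  satisfies the coordinate equations and is bounded on compact intervals, so it solves an equation clipped
  at a larger radius; this gives uniqueness and transfers the estimates to all weak solutions.\<close>

section \<open>Square summable sequences\<close>

lemma ell2_eqI: "(\<And>n. coord u n = coord v n) \<Longrightarrow> u = v"
  using coord_inject[of u v] by blast

lemma coord_at_0 [simp]: "coord u 0 = 0"
  using coord[of u] by (simp add: square_summable_def)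

lemma coord_cscale [simp]: "coord (z *\<^sub>C u) = (\<lambda>n. z * coord u n)"
  unfolding cscale_def by (rule Ell2_inverse[OF square_summable_mult[OF coord]])

lemma coord_sum: "coord (\<Sum>i\<in>A. f i) n = (\<Sum>i\<in>A. coord (f i) n)"
  by (induction A rule: infinite_finite_induct) simp_all

lemma norm_square_sums: "(\<lambda>n. (cmod (coord u n))\<^sup>2) sums (norm u)\<^sup>2"
proof -
  have "cinner u u = (\<Sum>n. complex_of_real ((cmod (coord u n))\<^sup>2))"
    by (simp only: cinner_def complex_norm_square)
  also have "\<dots> = complex_of_real (\<Sum>n. (cmod (coord u n))\<^sup>2)"
    by (rule suminf_of_real[OF summable_coord_square, symmetric])
  finally have "u \<bullet> u = (\<Sum>n. (cmod (coord u n))\<^sup>2)"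
    by (simp only: inner_ell2_def Re_complex_of_real)
  then show ?thesis
    using summable_sums[OF summable_coord_square[of u]] by (simp only: power2_norm_eq_inner[symmetric])
qed

lemma sum_coord_le_norm:
  assumes "finite A"
  shows "(\<Sum>n\<in>A. (cmod (coord u n))\<^sup>2) \<le> (norm u)\<^sup>2"
  using sum_le_suminf[OF summable_coord_square assms, of u] norm_square_sums[of u]
  by (simp add: sums_iff)

lemma cmod_coord_le_norm: "cmod (coord u n) \<le> norm u"
  using sum_coord_le_norm[of "{n}" u] by (simp add: power2_le_iff_abs_le)

lemma norm_le_if_partial_sums_le:
  assumes "\<And>m. (\<Sum>n<m. (cmod (coord u n))\<^sup>2) \<le> C\<^sup>2" "C \<ge> 0"
  shows "norm u \<le> C"
proof -
  have "(norm u)\<^sup>2 \<le> C\<^sup>2"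
    using suminf_le_const[OF summable_coord_square assms(1)] norm_square_sums[of u]
    by (simp add: sums_iff)
  then show ?thesis using assms(2) by (simp add: power2_le_iff_abs_le)
qed

lemma summable_if_partial_sums_le:
  fixes g :: "nat \<Rightarrow> real"
  assumes "\<And>n. g n \<ge> 0" "\<And>m. (\<Sum>n<m. g n) \<le> C"
  shows "summable g"
  by (rule bounded_imp_summable[of _ C]) (simp_all only: assms lessThan_Suc_atMost[symmetric])

lemma square_summableI:
  assumes "x 0 = 0" "\<And>m. (\<Sum>n<m. (cmod (x n))\<^sup>2) \<le> C"
  shows "x \<in> square_summable"
  using assms summable_if_partial_sums_le[of "\<lambda>n. (cmod (x n))\<^sup>2" C]
  by (simp add: square_summable_def)

lemma coord_Ell2:
  assumes "x 0 = 0" "\<And>m. (\<Sum>n<m. (cmod (x n))\<^sup>2) \<le> C"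
  shows "coord (Ell2 x) = x"
  by (rule Ell2_inverse[OF square_summableI[OF assms]])

lemma bounded_linear_coord: "bounded_linear (\<lambda>u. coord u n)"
  by (rule bounded_linear_intro[of _ 1]) (simp_all add: scaleR_conv_of_real cmod_coord_le_norm)

lemmas continuous_on_coord [continuous_intros] =
  bounded_linear.continuous_on[OF bounded_linear_coord]

text \<open>The coordinates of a Cauchy sequence converge; since the partial sums of the squared norm of a
  difference pass to the limit, the coordinatewise limit is the limit in norm.\<close>

instance ell2 :: complete_space
proof
  fix X :: "nat \<Rightarrow> ell2"
  assume X: "Cauchy X"
  have "\<exists>l. (\<lambda>i. coord (X i) n) \<longlonglongrightarrow> l" for n
    using bounded_linear.Cauchy[OF bounded_linear_coord X]
    by (simp add: Cauchy_convergent_iff convergent_def)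
  then obtain x where x: "\<And>n. (\<lambda>i. coord (X i) n) \<longlonglongrightarrow> x n"
    by metis
  have lim: "(\<Sum>n<m. (cmod (coord (X i) n - x n))\<^sup>2) \<le> e\<^sup>2"
    if "\<And>j. j \<ge> i \<Longrightarrow> norm (X i - X j) \<le> e" for i m e
  proof (rule LIMSEQ_le_const2)
    show "(\<lambda>j. \<Sum>n<m. (cmod (coord (X i) n - coord (X j) n))\<^sup>2)
        \<longlonglongrightarrow> (\<Sum>n<m. (cmod (coord (X i) n - x n))\<^sup>2)"
      by (intro tendsto_intros x)
    have "(\<Sum>n<m. (cmod (coord (X i) n - coord (X j) n))\<^sup>2) \<le> e\<^sup>2" if "j \<ge> i" for j
      using sum_coord_le_norm[of "{..<m}" "X i - X j"]
        power_mono[OF \<open>\<And>j. j \<ge> i \<Longrightarrow> norm (X i - X j) \<le> e\<close>[OF that], of 2]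
      by simp
    then show "\<exists>M. \<forall>j\<ge>M. (\<Sum>n<m. (cmod (coord (X i) n - coord (X j) n))\<^sup>2) \<le> e\<^sup>2"
      by blast
  qed
  have tail: "\<exists>M. \<forall>i\<ge>M. \<forall>j\<ge>i. norm (X i - X j) \<le> e" if "e > 0" for e
    using X that unfolding Cauchy_def dist_norm by (meson less_imp_le order_trans)
  obtain M where M: "\<And>j. j \<ge> M \<Longrightarrow> norm (X M - X j) \<le> 1"
    using tail[of 1] by auto
  have "x 0 = 0"
    using x[of 0] LIMSEQ_unique[OF tendsto_const] by fastforce
  then have d: "(\<lambda>n. coord (X M) n - x n) \<in> square_summable"
    by (intro square_summableI[of _ "1\<^sup>2"] lim M) simp_all
  have "coord (X M - Ell2 (\<lambda>n. coord (X M) n - x n)) = x"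
    by (simp add: Ell2_inverse[OF d])
  then obtain L where L: "coord L = x" by blast
  have "X \<longlonglongrightarrow> L"
  proof (rule metric_LIMSEQ_I)
    fix e :: real assume "e > 0"
    then obtain M where "\<forall>i\<ge>M. \<forall>j\<ge>i. norm (X i - X j) \<le> e/2"
      using tail[of "e/2"] by auto
    then have "norm (X i - L) \<le> e/2" if "i \<ge> M" for i
      using that \<open>e > 0\<close> lim[of i "e/2"]
      by (intro norm_le_if_partial_sums_le) (simp_all add: L)
    then show "\<exists>M. \<forall>i\<ge>M. dist (X i) L < e"
      using \<open>e > 0\<close> unfolding dist_norm by (metis field_sum_of_halves less_add_same_cancel1 order_le_less_trans half_gt_zero)
  qed
  then show "convergent X" by (rule convergentI)
qed

instance ell2 :: banach ..

lemma norm_cscale [simp]: "norm (z *\<^sub>C u) = cmod z * norm u"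
proof -
  have "(\<lambda>n. (cmod (coord (z *\<^sub>C u) n))\<^sup>2) sums ((cmod z)\<^sup>2 * (norm u)\<^sup>2)"
    using sums_mult[OF norm_square_sums] by (simp add: norm_mult power_mult_distrib)
  then have "(norm (z *\<^sub>C u))\<^sup>2 = (cmod z * norm u)\<^sup>2"
    using norm_square_sums sums_unique2 by (metis power_mult_distrib)
  then show ?thesis by (simp add: power2_eq_iff_nonneg)
qed

lemma bounded_linear_cscale_left: "bounded_linear (\<lambda>z. z *\<^sub>C u)"
  by (rule bounded_linear_intro[of _ "norm u"])
    (auto intro!: ell2_eqI simp: algebra_simps scaleR_conv_of_real)

lemma cinner_cscale_left: "cinner (z *\<^sub>C u) v = z * cinner u v"
  unfolding cinner_def coord_cscale mult.assoc by (rule suminf_mult[OF summable_coord_mult_cnj])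

lemma cinner_add_left: "cinner (u + v) w = cinner u w + cinner v w"
  unfolding cinner_def coord_add distrib_right
  by (rule suminf_add[symmetric]) (rule summable_coord_mult_cnj)+

lemma cinner_commute: "cinner v u = cnj (cinner u v)"
proof -
  have "(\<lambda>n. cnj (coord u n * cnj (coord v n))) sums cnj (cinner u v)"
    unfolding sums_cnj cinner_def by (rule summable_sums[OF summable_coord_mult_cnj])
  then show ?thesis
    unfolding cinner_def by (simp add: sums_iff mult.commute)
qed

lemma cinner_scaleR_left: "cinner (r *\<^sub>R u) v = r * cinner u v"
  using cinner_cscale_left[of "of_real r" u v] 
  by (metis coord_cscale coord_scaleR ell2_eqI)

text \<open>A rotation of \<open>u\<close> by a complex number of modulus 1 makes the complex inner product real and
  nonnegative, which reduces the claim to Cauchy-Schwarz for the real inner product.\<close>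

lemma cmod_cinner_le: "cmod (cinner u v) \<le> norm u * norm v"
proof (cases "cinner u v = 0")
  case False
  define z where "z = cnj (sgn (cinner u v))"
  have "z * cinner u v = of_real (cmod (cinner u v))"
    unfolding z_def using False
    by (simp add: sgn_eq complex_norm_square[symmetric] power2_eq_square field_simps
      complex_mult_cnj cmod_power2[symmetric])
  then have "cmod (cinner u v) = (z *\<^sub>C u) \<bullet> v"
    by (simp add: inner_ell2_def cinner_cscale_left)
  also have "\<dots> \<le> norm (z *\<^sub>C u) * norm v"
    by (rule norm_cauchy_schwarz)
  finally show ?thesis
    using False by (simp add: z_def norm_sgn)
qed simp

lemma bounded_linear_cinner_left: "bounded_linear (\<lambda>u. cinner u v)"
  by (rule bounded_linear_intro[of _ "norm v"])
    (simp_all add: cinner_add_left cinner_scaleR_left scaleR_conv_of_real cmod_cinner_le)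

definition unit_vector :: "nat \<Rightarrow> ell2" where
  "unit_vector n = Ell2 (\<lambda>i. if i = n \<and> n > 0 then 1 else 0)"

lemma coord_unit_vector [simp]: "coord (unit_vector n) = (\<lambda>i. if i = n \<and> n > 0 then 1 else 0)"
  unfolding unit_vector_def
proof (rule coord_Ell2)
  show "(\<Sum>i<m. (cmod (if i = n \<and> n > 0 then 1 else 0))\<^sup>2) \<le> 1" for m
    by (cases "n > 0") (simp_all add: if_distrib[of cmod] if_distrib[of "\<lambda>x. x\<^sup>2"] cong: if_cong)
qed auto

section \<open>Diagonal operators and truncations\<close>

definition diag :: "(nat \<Rightarrow> real) \<Rightarrow> ell2 \<Rightarrow> ell2" where
  "diag d u = Ell2 (\<lambda>n. of_real (d n) * coord u n)"

lemma
  assumes "\<And>n. \<bar>d n\<bar> \<le> C"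
  shows coord_diag_bounded: "coord (diag d u) = (\<lambda>n. of_real (d n) * coord u n)"
    and norm_diag_le: "norm (diag d u) \<le> C * norm u"
proof -
  have "C \<ge> 0" using assms[of 0] by linarith
  have *: "(\<Sum>n<m. (cmod (of_real (d n) * coord u n))\<^sup>2) \<le> (C * norm u)\<^sup>2" for m
  proof -
    have "(\<Sum>n<m. (cmod (of_real (d n) * coord u n))\<^sup>2) \<le> (\<Sum>n<m. C\<^sup>2 * (cmod (coord u n))\<^sup>2)"
      unfolding norm_mult power_mult_distrib using assms \<open>C \<ge> 0\<close>
      by (intro sum_mono mult_right_mono) (auto simp: power_mono intro: power2_le_iff_abs_le[THEN iffD2])
    also have "\<dots> \<le> (C * norm u)\<^sup>2"
      unfolding sum_distrib_left[symmetric] power_mult_distrib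
      by (intro mult_left_mono sum_coord_le_norm) simp_all
    finally show ?thesis .
  qed
  show c: "coord (diag d u) = (\<lambda>n. of_real (d n) * coord u n)"
    unfolding diag_def by (rule coord_Ell2[OF _ *]) simp
  show "norm (diag d u) \<le> C * norm u"
    using * \<open>C \<ge> 0\<close> by (intro norm_le_if_partial_sums_le) (simp_all add: c)
qed

lemma bounded_linear_diag:
  assumes "\<And>n. \<bar>d n\<bar> \<le> C"
  shows "bounded_linear (diag d)"
  using norm_diag_le[OF assms]
  by (intro bounded_linear_intro[of _ C] ell2_eqI)
    (simp_all add: coord_diag_bounded[OF assms] algebra_simps)

text \<open>A diagonal operator need not be bounded, but its composition with a truncation is. This makes
  \<open>A\<^sup>1\<^sup>/\<^sup>2 P\<^sub>m\<close> and \<open>A P\<^sub>m\<close> bounded operators on the whole space.\<close>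

definition cut :: "nat \<Rightarrow> (nat \<Rightarrow> real) \<Rightarrow> nat \<Rightarrow> real" where
  "cut m d n = (if n < m then d n else 0)"

lemma cut_bounded: "\<bar>cut m d n\<bar> \<le> (\<Sum>i<m. \<bar>d i\<bar>)"
  unfolding cut_def by (auto intro!: member_le_sum sum_nonneg)

lemmas coord_diag_cut [simp] = coord_diag_bounded[OF cut_bounded]
lemmas bounded_linear_diag_cut = bounded_linear_diag[OF cut_bounded]
lemmas continuous_on_diag_cut [continuous_intros] =
  bounded_linear.continuous_on[OF bounded_linear_diag_cut]

lemma norm_diag_cut_square:
  "(norm (diag (cut m d) u))\<^sup>2 = (\<Sum>n<m. (d n)\<^sup>2 * (cmod (coord u n))\<^sup>2)"
proof -
  have "(\<lambda>n. (cmod (coord (diag (cut m d) u) n))\<^sup>2) sums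
    (\<Sum>n<m. (cmod (coord (diag (cut m d) u) n))\<^sup>2)"
    by (rule sums_finite) (auto simp: cut_def)
  then have "(norm (diag (cut m d) u))\<^sup>2 = (\<Sum>n<m. (cmod (coord (diag (cut m d) u) n))\<^sup>2)"
    using norm_square_sums sums_unique2 by blast
  also have "\<dots> = (\<Sum>n<m. (d n)\<^sup>2 * (cmod (coord u n))\<^sup>2)"
    by (rule sum.cong) (auto simp: cut_def norm_mult power_mult_distrib)
  finally show ?thesis .
qed

abbreviation trunc :: "nat \<Rightarrow> ell2 \<Rightarrow> ell2" where
  "trunc m \<equiv> diag (cut m (\<lambda>_. 1))"

lemma norm_trunc_le: "norm (trunc m u) \<le> norm u"
  using norm_diag_le[of "cut m (\<lambda>_. 1)" 1 u] by (simp add: cut_def)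

lemma norm_diff_trunc_square:
  "(norm (u - trunc m u))\<^sup>2 = (norm u)\<^sup>2 - (\<Sum>n<m. (cmod (coord u n))\<^sup>2)"
proof -
  have "(\<lambda>n. (cmod (coord u n))\<^sup>2 - (if n < m then (cmod (coord u n))\<^sup>2 else 0)) sums
     ((norm u)\<^sup>2 - (\<Sum>n\<in>{..<m}. (cmod (coord u n))\<^sup>2))"
    using sums_If_finite_set[of "{..<m}" "\<lambda>n. (cmod (coord u n))\<^sup>2"]
    by (intro sums_diff norm_square_sums) simp
  moreover have "(cmod (coord u n))\<^sup>2 - (if n < m then (cmod (coord u n))\<^sup>2 else 0) =
      (cmod (coord (u - trunc m u) n))\<^sup>2" for n
    by (simp add: cut_def)
  ultimately show ?thesis
    using norm_square_sums[of "u - trunc m u"] sums_unique2 by fastforce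
qed

lemma trunc_tendsto: "(\<lambda>m. trunc m u) \<longlonglongrightarrow> u"
proof -
  have "(\<lambda>m. (norm u)\<^sup>2 - (\<Sum>n<m. (cmod (coord u n))\<^sup>2)) \<longlonglongrightarrow> (norm u)\<^sup>2 - (norm u)\<^sup>2"
    using norm_square_sums[of u] unfolding sums_def by (intro tendsto_intros)
  then have "(\<lambda>m. sqrt ((norm (u - trunc m u))\<^sup>2)) \<longlonglongrightarrow> sqrt 0"
    unfolding norm_diff_trunc_square by (intro tendsto_real_sqrt) simp
  then have "(\<lambda>m. norm (trunc m u - u)) \<longlonglongrightarrow> 0"
    by (simp add: norm_minus_commute)
  then show ?thesis
    by (simp add: tendsto_norm_zero_iff LIM_zero_cancel)
qed

lemma trunc_eq_sum: "trunc m u = (\<Sum>n<m. coord u n *\<^sub>C unit_vector n)"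
proof (rule ell2_eqI)
  fix i
  have "(\<Sum>n<m. coord (coord u n *\<^sub>C unit_vector n) i) = (\<Sum>n<m. if n = i then coord u i else 0)"
    by (rule sum.cong) (auto simp: gr0_conv_Suc, metis coord_at_0 not0_implies_Suc)
  then show "coord (trunc m u) i = coord (\<Sum>n<m. coord u n *\<^sub>C unit_vector n) i"
    by (simp add: coord_sum cut_def)
qed

lemma has_vector_derivative_trunc:
  assumes "\<And>n. n < m \<Longrightarrow> ((\<lambda>s. coord (w s) n) has_vector_derivative coord D n) F"
  shows "((\<lambda>s. trunc m (w s)) has_vector_derivative trunc m D) F"
  unfolding trunc_eq_sum
  by (intro has_vector_derivative_sum bounded_linear.has_vector_derivative[OF bounded_linear_cscale_left] assms)
    simp

text \<open>A majorant of the squared coordinates that is uniform in time makes the tails uniformly small.\<close>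

lemma continuous_on_if_coord_dominated:
  fixes w :: "'a::topological_space \<Rightarrow> ell2"
  assumes cont: "\<And>n. continuous_on S (\<lambda>t. coord (w t) n)"
    and le: "\<And>n t. t \<in> S \<Longrightarrow> (cmod (coord (w t) n))\<^sup>2 \<le> M n" and M: "summable M"
  shows "continuous_on S w"
proof (rule uniform_limit_theorem)
  show "uniform_limit S (\<lambda>m t. trunc m (w t)) w sequentially"
  proof (rule uniform_limitI)
    fix e :: real assume "e > 0"
    then obtain m0 where m0: "\<And>m. m \<ge> m0 \<Longrightarrow> norm (suminf (\<lambda>i. M (i + m))) < e\<^sup>2"
      using suminf_exist_split[OF _ M, of "e\<^sup>2"] by auto
    have "dist (trunc m (w t)) (w t) < e" if "m \<ge> m0" "t \<in> S" for m t
    proof -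
      have s: "summable (\<lambda>n. (cmod (coord (w t) n))\<^sup>2)" by (rule summable_coord_square)
      have "(norm (w t - trunc m (w t)))\<^sup>2 = (\<Sum>i. (cmod (coord (w t) (i + m)))\<^sup>2)"
        unfolding norm_diff_trunc_square using norm_square_sums[of "w t"]
        by (simp add: suminf_minus_initial_segment[OF s] sums_iff)
      also have "\<dots> \<le> (\<Sum>i. M (i + m))"
        using s M le[OF that(2)] by (intro suminf_le summable_ignore_initial_segment)
      also have "\<dots> < e\<^sup>2" using m0[OF that(1)] by simp
      finally show ?thesis
        using \<open>e > 0\<close> by (simp add: dist_norm norm_minus_commute power_less_imp_less_base less_imp_le)
    qed
    then show "\<forall>\<^sub>F m in sequentially. \<forall>t\<in>S. dist (trunc m (w t)) (w t) < e"
      unfolding eventually_sequentially by blast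
  qed
  show "\<forall>\<^sub>F m in sequentially. continuous_on S (\<lambda>t. trunc m (w t))"
    unfolding trunc_eq_sum
    by (intro always_eventually allI continuous_on_sum bounded_linear.continuous_on[OF bounded_linear_cscale_left] cont)
qed simp

section \<open>The bilinear map of the shell model\<close>

definition neighbours :: "ell2 \<Rightarrow> nat \<Rightarrow> real" where
  "neighbours x n = cmod (coord x (n + 2)) + cmod (coord x (n + 1))
     + cmod (coord x (n - 1)) + cmod (coord x (n - 2))"

lemma sum_pred_le:
  fixes g :: "nat \<Rightarrow> real"
  assumes "g 0 = 0" "\<And>n. g n \<ge> 0"
  shows "(\<Sum>n<m. g (n - 1)) \<le> (\<Sum>n<m. g n)"
proof (cases m)
  case (Suc l)
  have "(\<Sum>n<Suc l. g (n - 1)) = (\<Sum>n<l. g n)"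
    using assms(1) by (subst sum.lessThan_Suc_shift) simp
  then show ?thesis using Suc assms(2) by simp
qed simp

text \<open>Shifts of the index are bounded on square summable sequences; the coordinate with index 0 is
  duplicated by the truncated subtraction, but it vanishes.\<close>

lemma
  assumes y: "\<And>n. cmod (y n) \<le> c * neighbours x n" "y 0 = 0" and c: "c \<ge> 0"
  shows coord_if_le_neighbours: "coord (Ell2 y) = y"
    and norm_if_le_neighbours: "norm (Ell2 y) \<le> 4 * c * norm x"
proof -
  let ?f = "\<lambda>n. (cmod (coord x n))\<^sup>2"
  have shift: "(\<Sum>n<m. ?f (n + j)) \<le> (norm x)\<^sup>2" for m j
  proof -
    have "(\<Sum>n<m. ?f (n + j)) = sum ?f ((\<lambda>n. n + j) ` {..<m})"
      by (subst sum.reindex) simp_all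
    then show ?thesis using sum_coord_le_norm[of "(\<lambda>n. n + j) ` {..<m}" x] by simp
  qed
  have pred: "(\<Sum>n<m. ?f (n - 1)) \<le> (norm x)\<^sup>2" for m
    using sum_pred_le[of ?f m] sum_coord_le_norm[of "{..<m}" x] by simp
  have pred2: "(\<Sum>n<m. ?f (n - 2)) \<le> (norm x)\<^sup>2" for m
    using sum_pred_le[of "\<lambda>n. ?f (n - 1)" m] pred[of m] by (simp add: numeral_2_eq_2)
  have sq: "(p + q + r + s)\<^sup>2 \<le> 4 * (p\<^sup>2 + q\<^sup>2 + r\<^sup>2 + s\<^sup>2)" for p q r s :: real
    using sum_squares_bound[of p q] sum_squares_bound[of p r] sum_squares_bound[of p s]
      sum_squares_bound[of q r] sum_squares_bound[of q s] sum_squares_bound[of r s]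
    by (simp add: power2_eq_square algebra_simps)
  have *: "(\<Sum>n<m. (cmod (y n))\<^sup>2) \<le> (4 * c * norm x)\<^sup>2" for m
  proof -
    have "(cmod (y n))\<^sup>2 \<le> c\<^sup>2 * (4 * (?f (n + 2) + ?f (n + 1) + ?f (n - 1) + ?f (n - 2)))" for n
    proof -
      have "(cmod (y n))\<^sup>2 \<le> (c * neighbours x n)\<^sup>2"
        by (rule power_mono[OF y(1)]) simp
      also have "\<dots> \<le> c\<^sup>2 * (4 * (?f (n + 2) + ?f (n + 1) + ?f (n - 1) + ?f (n - 2)))"
        unfolding power_mult_distrib neighbours_def by (intro mult_left_mono sq) simp
      finally show ?thesis .
    qed
    then have "(\<Sum>n<m. (cmod (y n))\<^sup>2)
        \<le> (\<Sum>n<m. c\<^sup>2 * (4 * (?f (n + 2) + ?f (n + 1) + ?f (n - 1) + ?f (n - 2))))"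
      by (rule sum_mono)
    also have "\<dots> = c\<^sup>2 * (4 * ((\<Sum>n<m. ?f (n + 2)) + (\<Sum>n<m. ?f (n + 1))
        + (\<Sum>n<m. ?f (n - 1)) + (\<Sum>n<m. ?f (n - 2))))"
      by (simp only: sum_distrib_left[symmetric] sum.distrib)
    also have "\<dots> \<le> c\<^sup>2 * (4 * ((norm x)\<^sup>2 + (norm x)\<^sup>2 + (norm x)\<^sup>2 + (norm x)\<^sup>2))"
      by (intro mult_left_mono add_mono shift pred pred2) simp_all
    finally show ?thesis by (simp add: power_mult_distrib)
  qed
  show 1: "coord (Ell2 y) = y"
    by (rule coord_Ell2[OF y(2) *])
  show "norm (Ell2 y) \<le> 4 * c * norm x"
    using * c by (intro norm_le_if_partial_sums_le) (simp_all only: 1, simp)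
qed

lemma B_seq_0 [simp]: "B_seq k a b u v 0 = 0"
  by (simp add: B_seq_def)

lemma B_seq_add_left: "B_seq k a b (u + u') v n = B_seq k a b u v n + B_seq k a b u' v n"
  and B_seq_add_right: "B_seq k a b u (v + v') n = B_seq k a b u v n + B_seq k a b u v' n"
  and B_seq_scaleR_left: "B_seq k a b (r *\<^sub>R u) v n = of_real r * B_seq k a b u v n"
  and B_seq_scaleR_right: "B_seq k a b u (r *\<^sub>R v) n = of_real r * B_seq k a b u v n"
  by (simp_all add: B_seq_def algebra_simps)

locale shell_model =
  fixes k0 lam \<nu> a b :: real and k :: "nat \<Rightarrow> real"
  assumes lam: "lam > 1" and k0: "k0 > 0" and k: "\<And>n. k n = k0 * lam ^ n" and \<nu>: "\<nu> > 0"
begin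

lemma k_pos [simp]: "k n > 0" and k_nonneg [simp]: "k n \<ge> 0" and k_nonzero [simp]: "k n \<noteq> 0"
  using lam k0 by (simp_all add: k)

lemma k_Suc: "k (Suc n) = lam * k n"
  by (simp add: k)

lemma k_mono: "i \<le> j \<Longrightarrow> k i \<le> k j"
  unfolding k using lam k0 by (intro mult_left_mono power_increasing) simp_all

lemma k0_le_k: "k0 \<le> k n"
  using k_mono[of 0 n] by (simp add: k)

lemma k_le_pred: "n > 0 \<Longrightarrow> k n \<le> lam * k (n - 1)"
  by (cases n) (simp_all add: k_Suc)

lemma k_mono_mult: "i \<le> j \<Longrightarrow> x \<ge> 0 \<Longrightarrow> k i * x \<le> k j * x"
  by (intro mult_right_mono k_mono)

lemma B_seq_le:
  assumes "k (n + 1) * cmod (coord v (n + 2)) * cmod (coord u (n + 1)) \<le> q1"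
    "k n * cmod (coord v (n + 1)) * cmod (coord u (n - 1)) \<le> q2"
    "k (n - 1) * cmod (coord u (n - 1)) * cmod (coord v (n - 2)) \<le> q3"
    "k (n - 1) * cmod (coord v (n - 1)) * cmod (coord u (n - 2)) \<le> q4"
  shows "cmod (B_seq k a b u v n) \<le> (\<bar>a\<bar> + \<bar>b\<bar>) * (q1 + q2 + q3 + q4)"
proof -
  let ?p1 = "k (n + 1) * cmod (coord v (n + 2)) * cmod (coord u (n + 1))"
  let ?p2 = "k n * cmod (coord v (n + 1)) * cmod (coord u (n - 1))"
  let ?p3 = "k (n - 1) * cmod (coord u (n - 1)) * cmod (coord v (n - 2))"
  let ?p4 = "k (n - 1) * cmod (coord v (n - 1)) * cmod (coord u (n - 2))"
  have q: "0 \<le> q1" "0 \<le> q2" "0 \<le> q3" "0 \<le> q4"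
    using assms by (meson order_trans mult_nonneg_nonneg k_nonneg norm_ge_zero)+
  have "cmod (B_seq k a b u v n) \<le> \<bar>a\<bar> * ?p1 + \<bar>b\<bar> * ?p2 + \<bar>a\<bar> * ?p3 + \<bar>b\<bar> * ?p4"
    unfolding B_seq_def
    by (auto simp: norm_mult abs_mult mult.assoc intro!: norm_triangle_le add_mono)
  also have "\<dots> \<le> (\<bar>a\<bar> + \<bar>b\<bar>) * q1 + (\<bar>a\<bar> + \<bar>b\<bar>) * q2 + (\<bar>a\<bar> + \<bar>b\<bar>) * q3 + (\<bar>a\<bar> + \<bar>b\<bar>) * q4"
    using assms q by (intro add_mono mult_mono) simp_all
  finally show ?thesis by (simp add: algebra_simps)
qed

lemma absorb_left: "\<kappa> * cmod y \<le> R \<Longrightarrow> \<kappa> * cmod y * cmod x \<le> R * cmod x"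
  and absorb_right: "\<kappa> * cmod y \<le> R \<Longrightarrow> \<kappa> * cmod x * cmod y \<le> R * cmod x"
  using mult_right_mono[of "\<kappa> * cmod y" R "cmod x"] by (simp_all add: mult_ac)

lemma B_seq_le_neighbours_right:
  assumes "k (n + 1) * cmod (coord u (n + 1)) \<le> R" "k n * cmod (coord u (n - 1)) \<le> R"
    "k (n - 1) * cmod (coord u (n - 1)) \<le> R" "k (n - 1) * cmod (coord u (n - 2)) \<le> R"
  shows "cmod (B_seq k a b u v n) \<le> (\<bar>a\<bar> + \<bar>b\<bar>) * R * neighbours v n"
proof -
  have "cmod (B_seq k a b u v n) \<le> (\<bar>a\<bar> + \<bar>b\<bar>) *
    (R * cmod (coord v (n + 2)) + R * cmod (coord v (n + 1))
      + R * cmod (coord v (n - 2)) + R * cmod (coord v (n - 1)))"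
    by (rule B_seq_le[OF absorb_right[OF assms(1)] absorb_right[OF assms(2)]
          absorb_left[OF assms(3)] absorb_right[OF assms(4)]])
  then show ?thesis by (simp add: neighbours_def algebra_simps)
qed

lemma B_seq_le_neighbours_left:
  assumes "k (n + 1) * cmod (coord v (n + 2)) \<le> R" "k n * cmod (coord v (n + 1)) \<le> R"
    "k (n - 1) * cmod (coord v (n - 2)) \<le> R" "k (n - 1) * cmod (coord v (n - 1)) \<le> R"
  shows "cmod (B_seq k a b u v n) \<le> 2 * (\<bar>a\<bar> + \<bar>b\<bar>) * R * neighbours u n"
proof -
  have "R \<ge> 0" using assms(1) by (meson order_trans mult_nonneg_nonneg k_nonneg norm_ge_zero)
  have "cmod (B_seq k a b u v n) \<le> (\<bar>a\<bar> + \<bar>b\<bar>) *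
    (R * cmod (coord u (n + 1)) + R * cmod (coord u (n - 1))
      + R * cmod (coord u (n - 1)) + R * cmod (coord u (n - 2)))"
    by (rule B_seq_le[OF absorb_left[OF assms(1)] absorb_left[OF assms(2)]
          absorb_right[OF assms(3)] absorb_left[OF assms(4)]])
  also have "\<dots> \<le> (\<bar>a\<bar> + \<bar>b\<bar>) * (2 * R * neighbours u n)"
    using \<open>R \<ge> 0\<close> by (intro mult_left_mono) (simp_all add: neighbours_def algebra_simps)
  finally show ?thesis by (simp add: algebra_simps)
qed

text \<open>Dividing by the wave number turns \<^const>\<open>B_seq\<close> into a bounded map on the Hilbert space, which
  is \<open>A\<^sup>-\<^sup>1\<^sup>/\<^sup>2 B\<close>; this encodes that \<open>B\<close> maps \<open>H \<times> H\<close> into the dual of \<open>V\<close>.\<close>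

definition weak_B :: "ell2 \<Rightarrow> ell2 \<Rightarrow> ell2" where
  "weak_B u v = Ell2 (\<lambda>n. of_real (1 / k n) * B_seq k a b u v n)"

lemma
  shows coord_weak_B: "coord (weak_B u v) = (\<lambda>n. of_real (1 / k n) * B_seq k a b u v n)"
    and norm_weak_B_le: "norm (weak_B u v) \<le> norm u * norm v * (4 * (\<bar>a\<bar> + \<bar>b\<bar>) * lam)"
proof -
  have "cmod (of_real (1 / k n) * B_seq k a b u v n)
      \<le> ((\<bar>a\<bar> + \<bar>b\<bar>) * (lam * norm u)) * neighbours v n" for n
  proof -
    have "k i * cmod (coord u j) \<le> lam * k n * norm u" if "i \<le> n + 1" for i j
      using k_mono[OF that] by (intro mult_mono cmod_coord_le_norm) (simp_all add: k_Suc order_less_imp_le[OF less_trans[OF zero_less_one lam]])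
    then have "cmod (B_seq k a b u v n) \<le> (\<bar>a\<bar> + \<bar>b\<bar>) * (lam * k n * norm u) * neighbours v n"
      by (intro B_seq_le_neighbours_right) simp_all
    then show ?thesis by (simp add: norm_mult norm_divide field_simps)
  qed
  from coord_if_le_neighbours[OF this] norm_if_le_neighbours[OF this]
  show "coord (weak_B u v) = (\<lambda>n. of_real (1 / k n) * B_seq k a b u v n)"
    "norm (weak_B u v) \<le> norm u * norm v * (4 * (\<bar>a\<bar> + \<bar>b\<bar>) * lam)"
    unfolding weak_B_def using lam by (simp_all add: mult_ac)
qed

lemma bounded_bilinear_weak_B: "bounded_bilinear weak_B"
proof
  show "\<exists>K. \<forall>u v. norm (weak_B u v) \<le> norm u * norm v * K"
    using norm_weak_B_le by blast
qed (auto intro!: ell2_eqI simp: coord_weak_B B_seq_add_left B_seq_add_right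
    B_seq_scaleR_left B_seq_scaleR_right algebra_simps)

text \<open>One of the two factors is estimated in \<open>H\<close> and the other one in \<open>V\<close>, so \<open>B(u,u)\<close> lies in \<open>H\<close> for
  \<open>u\<close> in \<open>V\<close>. Only the coordinates up to \<open>m + 1\<close> enter the truncation at \<open>m\<close>.\<close>

lemma norm_trunc_B_le:
  "norm (diag (cut m k) (weak_B u u)) \<le> 8 * (\<bar>a\<bar> + \<bar>b\<bar>) * norm u * norm (diag (cut (m + 2) k) u)"
proof -
  define x where "x = diag (cut (m + 2) k) u"
  have x: "cmod (coord x j) = k j * cmod (coord u j)" if "j < m + 2" for j
    using that by (simp add: x_def cut_def norm_mult)
  have "cmod (coord (diag (cut m k) (weak_B u u)) n)
      \<le> (2 * (\<bar>a\<bar> + \<bar>b\<bar>) * norm u) * neighbours x n" for n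
  proof (cases "n < m")
    case True
    have le: "k i * cmod (coord u j) * cmod (coord u l) \<le> cmod (coord x j) * norm u"
      if "i \<le> j" "j \<le> n + 2" for i j l
      using that True k_mono_mult by (intro mult_mono cmod_coord_le_norm) (simp_all add: x)
    have "cmod (B_seq k a b u u n) \<le> (\<bar>a\<bar> + \<bar>b\<bar>) *
      (cmod (coord x (n + 2)) * norm u + cmod (coord x (n + 1)) * norm u
        + cmod (coord x (n - 1)) * norm u + cmod (coord x (n - 1)) * norm u)"
      by (intro B_seq_le le) simp_all
    also have "\<dots> \<le> (\<bar>a\<bar> + \<bar>b\<bar>) * (2 * norm u * neighbours x n)"
      by (intro mult_left_mono) (simp_all add: neighbours_def algebra_simps)
    finally show ?thesis
      using True by (simp add: coord_weak_B cut_def algebra_simps)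
  next
    case False
    then show ?thesis by (simp add: cut_def neighbours_def)
  qed
  then have "norm (Ell2 (coord (diag (cut m k) (weak_B u u)))) \<le> 4 * (2 * (\<bar>a\<bar> + \<bar>b\<bar>) * norm u) * norm x"
    by (intro norm_if_le_neighbours) simp_all
  then show ?thesis
    unfolding coord_inverse x_def by (simp only: mult.assoc[symmetric])
qed

definition B_linearized :: "ell2 \<Rightarrow> ell2 \<Rightarrow> ell2" where
  "B_linearized v u = Ell2 (\<lambda>n. B_seq k a b u v n + B_seq k a b v u n)"

text \<open>If \<open>v\<close> lies in \<open>V\<close>, then \<open>k n\<close> is absorbed by \<open>v\<close>, so the linearization of \<open>B\<close> about \<open>v\<close> is bounded
  on the whole space.\<close>

lemma
  assumes D: "\<And>j. k j * cmod (coord v j) \<le> D"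
  shows coord_B_linearized:
      "coord (B_linearized v u) = (\<lambda>n. B_seq k a b u v n + B_seq k a b v u n)"
    and bounded_linear_B_linearized: "bounded_linear (B_linearized v)"
proof -
  have "D \<ge> 0" using D[of 0] by simp
  have up: "k i * cmod (coord v j) \<le> lam * D" if "i \<le> j" for i j
  proof -
    have "k i * cmod (coord v j) \<le> D"
      using k_mono_mult[OF that norm_ge_zero] D order_trans by blast
    also have "D \<le> lam * D" using lam \<open>D \<ge> 0\<close> by (simp add: mult_le_cancel_right1)
    finally show ?thesis .
  qed
  have down: "k i * cmod (coord v (i - 1)) \<le> lam * D" for i
  proof (cases "i = 0")
    case False
    then have "k i * cmod (coord v (i - 1)) \<le> lam * k (i - 1) * cmod (coord v (i - 1))"
      by (intro mult_right_mono k_le_pred) simp_all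
    also have "\<dots> \<le> lam * D" using lam D[of "i - 1"] by (simp add: mult.assoc)
    finally show ?thesis .
  qed (use lam \<open>D \<ge> 0\<close> in simp)
  have down': "k (i - 1) * cmod (coord v (i - 2)) \<le> lam * D" for i
    using down[of "i - 1"] by (simp add: numeral_2_eq_2)
  let ?c = "3 * (\<bar>a\<bar> + \<bar>b\<bar>) * (lam * D)"
  have *: "cmod (B_seq k a b u v n + B_seq k a b v u n) \<le> ?c * neighbours u n" for u n
  proof -
    have "cmod (B_seq k a b u v n) \<le> 2 * (\<bar>a\<bar> + \<bar>b\<bar>) * (lam * D) * neighbours u n"
      by (intro B_seq_le_neighbours_left up down') simp_all
    moreover have "cmod (B_seq k a b v u n) \<le> (\<bar>a\<bar> + \<bar>b\<bar>) * (lam * D) * neighbours u n"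
      by (intro B_seq_le_neighbours_right up down down') simp_all
    ultimately show ?thesis
      using norm_triangle_ineq[of "B_seq k a b u v n" "B_seq k a b v u n"] by (simp add: algebra_simps)
  qed
  have c: "?c \<ge> 0" using lam \<open>D \<ge> 0\<close> by simp
  have coord: "coord (B_linearized v u) = (\<lambda>n. B_seq k a b u v n + B_seq k a b v u n)" for u
    unfolding B_linearized_def by (intro coord_if_le_neighbours[OF * _ c]) simp
  then show "coord (B_linearized v u) = (\<lambda>n. B_seq k a b u v n + B_seq k a b v u n)" .
  have "norm (B_linearized v u) \<le> 4 * ?c * norm u" for u
    unfolding B_linearized_def by (intro norm_if_le_neighbours[OF * _ c]) simp
  then show "bounded_linear (B_linearized v)"
    by (intro bounded_linear_intro[of _ "4 * ?c"] ell2_eqI)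
      (simp_all add: coord B_seq_add_left B_seq_add_right B_seq_scaleR_left B_seq_scaleR_right algebra_simps)
qed

subsection \<open>The spaces \<open>V\<close> and \<open>D(A)\<close>\<close>

lemma A_pow_seq_half: "A_pow_seq k (1/2) u n = of_real (k n) * coord u n"
  by (simp add: A_pow_seq_def)

lemma A_pow_seq_one: "A_pow_seq k 1 u n = of_real ((k n)\<^sup>2) * coord u n"
  by (simp add: A_pow_seq_def)

lemma V_space_iff: "u \<in> V_space k \<longleftrightarrow> summable (\<lambda>n. (k n)\<^sup>2 * (cmod (coord u n))\<^sup>2)"
  by (simp add: V_space_def dom_A_pow_def square_summable_def A_pow_seq_half norm_mult power_mult_distrib)

lemma V_norm_sums:
  assumes "u \<in> V_space k"
  shows "(\<lambda>n. (k n)\<^sup>2 * (cmod (coord u n))\<^sup>2) sums (V_norm k u)\<^sup>2"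
proof -
  have "coord (A_pow k (1/2) u) = A_pow_seq k (1/2) u"
    using assms by (simp add: A_pow_def V_space_def dom_A_pow_def Ell2_inverse)
  then show ?thesis
    using norm_square_sums[of "A_pow k (1/2) u"]
    by (simp add: V_norm_def A_pow_seq_half norm_mult power_mult_distrib)
qed

lemma V_coord_bounded:
  assumes "u \<in> V_space k"
  shows "k j * cmod (coord u j) \<le> V_norm k u"
proof -
  have "(k j * cmod (coord u j))\<^sup>2 \<le> (V_norm k u)\<^sup>2"
    using V_norm_sums[OF assms] sum_le_suminf[of "\<lambda>n. (k n)\<^sup>2 * (cmod (coord u n))\<^sup>2" "{j}"]
    by (simp add: sums_iff power_mult_distrib)
  then show ?thesis by (simp add: V_norm_def power2_le_iff_abs_le)
qed

lemma diag_cut_in_dom: "diag (cut m d) u \<in> dom_A_pow k s"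
proof -
  have "summable (\<lambda>n. (cmod (A_pow_seq k s (diag (cut m d) u) n))\<^sup>2)"
    by (rule summable_finite[of "{..<m}"]) (auto simp: A_pow_seq_def cut_def)
  then show ?thesis
    by (simp add: dom_A_pow_def square_summable_def A_pow_seq_def)
qed

lemma V_spaceI_bounded:
  assumes "\<And>m. norm (diag (cut m k) u) \<le> C"
  shows "u \<in> V_space k"
proof -
  have "(\<Sum>n<m. (k n)\<^sup>2 * (cmod (coord u n))\<^sup>2) \<le> C\<^sup>2" for m
    unfolding norm_diag_cut_square[symmetric] by (rule power_mono[OF assms]) simp
  then show ?thesis
    unfolding V_space_iff
    by (intro summable_if_partial_sums_le) simp_all
qed

lemma unit_vector_in_V: "unit_vector n \<in> V_space k"
  unfolding V_space_iff by (rule summable_finite[of "{n}"]) auto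

lemma bounded_linear_A_inv_half: "bounded_linear (diag (\<lambda>n. 1 / k n))"
  and coord_A_inv_half: "coord (diag (\<lambda>n. 1 / k n) u) = (\<lambda>n. of_real (1 / k n) * coord u n)"
proof -
  have *: "\<bar>1 / k n\<bar> \<le> 1 / k0" for n
    using k0_le_k[of n] k0 by (simp add: frac_le)
  show "bounded_linear (diag (\<lambda>n. 1 / k n))" by (rule bounded_linear_diag[OF *])
  show "coord (diag (\<lambda>n. 1 / k n) u) = (\<lambda>n. of_real (1 / k n) * coord u n)"
    by (rule coord_diag_bounded[OF *])
qed

end

section \<open>Forced diagonal equations\<close>

lemma integral_exp_le:
  assumes "c > 0" "\<tau> \<ge> (0::real)"
  shows "integral {0..\<tau>} (\<lambda>s. exp (c * s)) \<le> exp (c * \<tau>) / c"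
proof -
  have "((\<lambda>s. exp (c * s)) has_integral exp (c * \<tau>) / c - exp (c * 0) / c) {0..\<tau>}"
    using assms by (intro fundamental_theorem_of_calculus)
      (auto intro!: derivative_eq_intros simp: has_real_derivative_iff_has_vector_derivative[symmetric])
  then show ?thesis
    using assms(1) by (simp add: integral_unique)
qed

lemma continuous_on_half_line:
  fixes w :: "real \<Rightarrow> 'a::topological_space"
  assumes "\<And>\<tau>. \<tau> \<ge> 0 \<Longrightarrow> continuous_on {0..\<tau>} w"
  shows "continuous_on {0..} w"
  unfolding continuous_on_eq_continuous_within
proof
  fix x :: real assume "x \<in> {0..}"
  then have "at x within {0..} = at x within {0..x+1}"
    by (intro at_within_nhd[of x "{..<x+1}"]) auto
  then show "continuous (at x within {0..}) w"
    using assms[of "x + 1"] \<open>x \<in> {0..}\<close> by (simp add: continuous_on_eq_continuous_within)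
qed

text \<open>Young's inequality absorbs the forcing into half of the damping \<open>2 \<mu> |y|\<^sup>2\<close> of \<open>|y|\<^sup>2\<close>.\<close>

lemma scalar_energy_estimate:
  fixes y g :: "real \<Rightarrow> complex"
  assumes \<mu>: "\<mu> > 0" and \<tau>: "\<tau> \<ge> 0" and g: "continuous_on {0..\<tau>} g"
    and y: "\<And>t. t \<in> {0..\<tau>} \<Longrightarrow> (y has_vector_derivative g t - of_real \<mu> * y t) (at t within {0..\<tau>})"
  shows "(cmod (y \<tau>))\<^sup>2 + \<mu> * integral {0..\<tau>} (\<lambda>s. (cmod (y s))\<^sup>2)
    \<le> (cmod (y 0))\<^sup>2 + integral {0..\<tau>} (\<lambda>s. (cmod (g s))\<^sup>2) / \<mu>"
proof -
  have cy: "continuous_on {0..\<tau>} y"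
    using y has_vector_derivative_continuous continuous_on_eq_continuous_within by blast
  let ?F' = "\<lambda>t. y t \<bullet> (g t - of_real \<mu> * y t) + (g t - of_real \<mu> * y t) \<bullet> y t"
  have "(?F' has_integral y \<tau> \<bullet> y \<tau> - y 0 \<bullet> y 0) {0..\<tau>}"
    by (intro fundamental_theorem_of_calculus \<tau>
        bounded_bilinear.has_vector_derivative[OF bounded_bilinear_inner] y)
  moreover have "((\<lambda>s. (cmod (g s))\<^sup>2 / \<mu> - \<mu> * (cmod (y s))\<^sup>2) has_integral
      integral {0..\<tau>} (\<lambda>s. (cmod (g s))\<^sup>2) / \<mu> - \<mu> * integral {0..\<tau>} (\<lambda>s. (cmod (y s))\<^sup>2)) {0..\<tau>}"
    by (intro has_integral_diff has_integral_divide has_integral_mult_right integrable_integral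
        integrable_continuous_real continuous_intros g cy)
  moreover have "?F' t \<le> (cmod (g t))\<^sup>2 / \<mu> - \<mu> * (cmod (y t))\<^sup>2" for t
  proof -
    have "0 \<le> (norm (g t - \<mu> *\<^sub>R y t))\<^sup>2 / \<mu>" using \<mu> by simp
    also have "\<dots> = (cmod (g t))\<^sup>2 / \<mu> - 2 * (y t \<bullet> g t) + \<mu> * (cmod (y t))\<^sup>2"
      using \<mu> by (simp add: power2_norm_eq_inner inner_diff_left inner_diff_right inner_commute field_simps)
    finally show ?thesis
      unfolding power2_norm_eq_inner
      by (simp add: scaleR_conv_of_real[symmetric] inner_diff_left inner_diff_right inner_commute)
  qed
  ultimately have "y \<tau> \<bullet> y \<tau> - y 0 \<bullet> y 0 \<le>
      integral {0..\<tau>} (\<lambda>s. (cmod (g s))\<^sup>2) / \<mu> - \<mu> * integral {0..\<tau>} (\<lambda>s. (cmod (y s))\<^sup>2)"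
    by (rule has_integral_le)
  then show ?thesis by (simp add: dot_square_norm)
qed

lemma scalar_solution_exists:
  fixes g :: "real \<Rightarrow> complex"
  assumes g: "continuous_on {0..} g"
  shows "\<exists>y. y 0 = y0 \<and> (\<forall>\<tau>\<ge>0. \<forall>t\<in>{0..\<tau>}.
    (y has_vector_derivative g t - of_real \<mu> * y t) (at t within {0..\<tau>}))"
proof -
  let ?J = "\<lambda>t. integral {0..t} (\<lambda>s. exp (\<mu> * s) *\<^sub>R g s)"
  let ?y = "\<lambda>t. exp (- \<mu> * t) *\<^sub>R (y0 + ?J t)"
  show ?thesis
  proof (intro exI[of _ ?y] conjI allI impI ballI)
  show "?y 0 = y0" by simp
  fix \<tau> t :: real assume "\<tau> \<ge> 0" and t: "t \<in> {0..\<tau>}"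
  have "(?J has_vector_derivative exp (\<mu> * t) *\<^sub>R g t) (at t within {0..\<tau>})"
    using t by (intro integral_has_vector_derivative continuous_intros continuous_on_subset[OF g]) auto
  then have J: "((\<lambda>t. y0 + ?J t) has_vector_derivative 0 + exp (\<mu> * t) *\<^sub>R g t) (at t within {0..\<tau>})"
    by (rule has_vector_derivative_add[OF has_vector_derivative_const])
  have "((\<lambda>t. exp (- \<mu> * t)) has_vector_derivative - \<mu> * exp (- \<mu> * t)) (at t within {0..\<tau>})"
    unfolding has_real_derivative_iff_has_vector_derivative[symmetric]
    by (auto intro!: derivative_eq_intros)
  from bounded_bilinear.has_vector_derivative[OF bounded_bilinear_scaleR this J]
  have "(?y has_vector_derivative exp (- \<mu> * t) *\<^sub>R (0 + exp (\<mu> * t) *\<^sub>R g t)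
      + (- \<mu> * exp (- \<mu> * t)) *\<^sub>R (y0 + ?J t)) (at t within {0..\<tau>})" .
  moreover have "exp (- \<mu> * t) *\<^sub>R (0 + exp (\<mu> * t) *\<^sub>R g t) + (- \<mu> * exp (- \<mu> * t)) *\<^sub>R (y0 + ?J t)
      = g t - of_real \<mu> * ?y t"
    by (simp add: scaleR_conv_of_real exp_minus field_simps)
  ultimately show "(?y has_vector_derivative g t - of_real \<mu> * ?y t) (at t within {0..\<tau>})"
    by simp
  qed
qed

context shell_model
begin

text \<open>\<open>w' + \<nu> A w = A\<^sup>1\<^sup>/\<^sup>2 h\<close> on \<open>[0, \<tau>]\<close>, coordinate by coordinate. The factor \<open>A\<^sup>1\<^sup>/\<^sup>2\<close> makes \<open>h\<close> a
  function with values in \<open>H\<close> when the forcing takes values in the dual of \<open>V\<close>.\<close>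

definition evolves :: "(real \<Rightarrow> ell2) \<Rightarrow> (real \<Rightarrow> ell2) \<Rightarrow> real \<Rightarrow> bool" where
  "evolves h w \<tau> \<longleftrightarrow> continuous_on {0..\<tau>} w \<and>
     (\<forall>n. \<forall>t\<in>{0..\<tau>}. ((\<lambda>s. coord (w s) n) has_vector_derivative
        of_real (k n) * coord (h t) n - of_real (\<nu> * (k n)\<^sup>2) * coord (w t) n) (at t within {0..\<tau>}))"

lemma evolves_subinterval: "evolves h w \<tau> \<Longrightarrow> \<sigma> \<le> \<tau> \<Longrightarrow> evolves h w \<sigma>"
  unfolding evolves_def
  by (auto intro: continuous_on_subset has_vector_derivative_within_subset[of _ _ _ "{0..\<tau>}"])

lemma evolves_diff:
  assumes "evolves h1 w1 \<tau>" "evolves h2 w2 \<tau>"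
  shows "evolves (\<lambda>t. h1 t - h2 t) (\<lambda>t. w1 t - w2 t) \<tau>"
  unfolding evolves_def
proof (intro conjI allI ballI)
  show "continuous_on {0..\<tau>} (\<lambda>t. w1 t - w2 t)"
    using assms by (auto simp: evolves_def intro!: continuous_intros)
  fix n t assume "t \<in> {0..\<tau>}"
  then have "((\<lambda>s. coord (w1 s) n - coord (w2 s) n) has_vector_derivative
      (of_real (k n) * coord (h1 t) n - of_real (\<nu> * (k n)\<^sup>2) * coord (w1 t) n)
      - (of_real (k n) * coord (h2 t) n - of_real (\<nu> * (k n)\<^sup>2) * coord (w2 t) n)) (at t within {0..\<tau>})"
    using assms by (intro has_vector_derivative_diff) (auto simp: evolves_def)
  then show "((\<lambda>s. coord (w1 s - w2 s) n) has_vector_derivative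
      of_real (k n) * coord (h1 t - h2 t) n - of_real (\<nu> * (k n)\<^sup>2) * coord (w1 t - w2 t) n)
      (at t within {0..\<tau>})"
    by (simp add: algebra_simps)
qed

lemma coordinate_energy_estimate:
  assumes y: "\<And>t. t \<in> {0..\<tau>} \<Longrightarrow> (y has_vector_derivative
       of_real (k n) * coord (h t) n - of_real (\<nu> * (k n)\<^sup>2) * y t) (at t within {0..\<tau>})"
    and h: "continuous_on {0..\<tau>} h" and "\<tau> \<ge> 0"
  shows "(cmod (y \<tau>))\<^sup>2 + \<nu> * integral {0..\<tau>} (\<lambda>s. (k n)\<^sup>2 * (cmod (y s))\<^sup>2)
    \<le> (cmod (y 0))\<^sup>2 + integral {0..\<tau>} (\<lambda>s. (cmod (coord (h s) n))\<^sup>2) / \<nu>"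
proof -
  have "(cmod (y \<tau>))\<^sup>2 + \<nu> * (k n)\<^sup>2 * integral {0..\<tau>} (\<lambda>s. (cmod (y s))\<^sup>2)
    \<le> (cmod (y 0))\<^sup>2 + integral {0..\<tau>} (\<lambda>s. (cmod (of_real (k n) * coord (h s) n))\<^sup>2) / (\<nu> * (k n)\<^sup>2)"
    using assms \<nu> by (intro scalar_energy_estimate continuous_intros) simp_all
  then show ?thesis
    using \<nu> by (simp add: norm_mult power_mult_distrib mult.assoc)
qed

lemma sum_integral_coord_le:
  fixes h :: "real \<Rightarrow> ell2"
  assumes h: "continuous_on {0..\<tau>} h"
  shows "(\<Sum>n<m. integral {0..\<tau>} (\<lambda>s. (cmod (coord (h s) n))\<^sup>2)) \<le> integral {0..\<tau>} (\<lambda>s. (norm (h s))\<^sup>2)"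
proof -
  have "(\<Sum>n<m. integral {0..\<tau>} (\<lambda>s. (cmod (coord (h s) n))\<^sup>2))
      = integral {0..\<tau>} (\<lambda>s. \<Sum>n<m. (cmod (coord (h s) n))\<^sup>2)"
    by (rule integral_sum[symmetric]) (simp, intro integrable_continuous_real continuous_intros h)
  also have "\<dots> \<le> integral {0..\<tau>} (\<lambda>s. (norm (h s))\<^sup>2)"
    by (intro integral_le integrable_continuous_real continuous_intros h sum_coord_le_norm) simp
  finally show ?thesis .
qed

lemma energy_estimate:
  assumes w: "evolves h w \<tau>" and h: "continuous_on {0..\<tau>} h" and \<tau>: "\<tau> \<ge> 0"
  shows "(\<Sum>n<m. (cmod (coord (w \<tau>) n))\<^sup>2) + \<nu> * integral {0..\<tau>} (\<lambda>s. (norm (diag (cut m k) (w s)))\<^sup>2)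
    \<le> (norm (w 0))\<^sup>2 + integral {0..\<tau>} (\<lambda>s. (norm (h s))\<^sup>2) / \<nu>"
proof -
  have "(\<Sum>n<m. (cmod (coord (w \<tau>) n))\<^sup>2
        + \<nu> * integral {0..\<tau>} (\<lambda>s. (k n)\<^sup>2 * (cmod (coord (w s) n))\<^sup>2))
      \<le> (\<Sum>n<m. (cmod (coord (w 0) n))\<^sup>2 + integral {0..\<tau>} (\<lambda>s. (cmod (coord (h s) n))\<^sup>2) / \<nu>)"
    using w by (intro sum_mono coordinate_energy_estimate h \<tau>) (auto simp: evolves_def)
  also have "\<dots> \<le> (norm (w 0))\<^sup>2 + integral {0..\<tau>} (\<lambda>s. (norm (h s))\<^sup>2) / \<nu>"
    using \<nu> unfolding sum.distrib sum_divide_distrib[symmetric]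
    by (intro add_mono divide_right_mono sum_coord_le_norm sum_integral_coord_le h) simp_all
  also have "(\<Sum>n<m. (cmod (coord (w \<tau>) n))\<^sup>2
        + \<nu> * integral {0..\<tau>} (\<lambda>s. (k n)\<^sup>2 * (cmod (coord (w s) n))\<^sup>2))
      = (\<Sum>n<m. (cmod (coord (w \<tau>) n))\<^sup>2)
        + \<nu> * integral {0..\<tau>} (\<lambda>s. (norm (diag (cut m k) (w s)))\<^sup>2)"
    unfolding norm_diag_cut_square sum.distrib sum_distrib_left[symmetric]
    using w by (subst integral_sum)
      (auto simp: evolves_def intro!: integrable_continuous_real continuous_intros)
  finally show ?thesis .
qed

lemma V_energy_bounded:
  assumes w: "evolves h w \<tau>" and h: "continuous_on {0..\<tau>} h" and \<tau>: "\<tau> \<ge> 0"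
  shows "integral {0..\<tau>} (\<lambda>s. (norm (diag (cut m k) (w s)))\<^sup>2)
    \<le> ((norm (w 0))\<^sup>2 + integral {0..\<tau>} (\<lambda>s. (norm (h s))\<^sup>2) / \<nu>) / \<nu>"
proof -
  have "0 \<le> (\<Sum>n<m. (cmod (coord (w \<tau>) n))\<^sup>2)" by (intro sum_nonneg) simp
  with energy_estimate[OF assms, of m]
  have "\<nu> * integral {0..\<tau>} (\<lambda>s. (norm (diag (cut m k) (w s)))\<^sup>2)
      \<le> (norm (w 0))\<^sup>2 + integral {0..\<tau>} (\<lambda>s. (norm (h s))\<^sup>2) / \<nu>"
    by linarith
  then show ?thesis using \<nu> by (simp add: pos_le_divide_eq mult.commute)
qed

lemma norm_energy_estimate:
  assumes w: "evolves h w \<tau>" and h: "continuous_on {0..\<tau>} h" and \<tau>: "\<tau> \<ge> 0"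
  shows "(norm (w \<tau>))\<^sup>2 \<le> (norm (w 0))\<^sup>2 + integral {0..\<tau>} (\<lambda>s. (norm (h s))\<^sup>2) / \<nu>"
proof -
  let ?E = "(norm (w 0))\<^sup>2 + integral {0..\<tau>} (\<lambda>s. (norm (h s))\<^sup>2) / \<nu>"
  have E: "?E \<ge> 0"
    using \<nu> by (intro add_nonneg_nonneg divide_nonneg_pos integral_nonneg
      integrable_continuous_real continuous_intros h) simp_all
  have "(\<Sum>n<m. (cmod (coord (w \<tau>) n))\<^sup>2) \<le> (sqrt ?E)\<^sup>2" for m
  proof -
    have "0 \<le> \<nu> * integral {0..\<tau>} (\<lambda>s. (norm (diag (cut m k) (w s)))\<^sup>2)"
      using \<nu> w by (intro mult_nonneg_nonneg integral_nonneg integrable_continuous_real continuous_intros)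
        (auto simp: evolves_def)
    then show ?thesis using energy_estimate[OF assms, of m] E by simp
  qed
  then have "norm (w \<tau>) \<le> sqrt ?E"
    using E by (intro norm_le_if_partial_sums_le) simp_all
  then show ?thesis
    using E by (simp add: real_le_rsqrt sqrt_ge_absD)
qed

text \<open>Each coordinate equation is solved by the variation of constants formula; the energy estimate
  shows that the coordinates form a continuous function with values in the Hilbert space.\<close>

lemma forced_solution_exists:
  assumes h: "continuous_on {0..} h"
  shows "\<exists>w. w 0 = w0 \<and> (\<forall>\<tau>\<ge>0. evolves h w \<tau>)"
proof -
  define sol where "sol n y \<longleftrightarrow> y 0 = coord w0 n \<and> (\<forall>\<tau>\<ge>0. \<forall>t\<in>{0..\<tau>}. (y has_vector_derivative
      of_real (k n) * coord (h t) n - of_real (\<nu> * (k n)\<^sup>2) * y t) (at t within {0..\<tau>}))" for n y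
  have "\<forall>n. \<exists>y. sol n y"
    unfolding sol_def by (intro allI scalar_solution_exists continuous_intros h)
  from choice[OF this] obtain y where ysol: "\<And>n. sol n (y n)" by blast
  have y0: "\<And>n. y n 0 = coord w0 n"
    and y: "\<And>\<tau> t n. t \<in> {0..\<tau>} \<Longrightarrow> (y n has_vector_derivative
      of_real (k n) * coord (h t) n - of_real (\<nu> * (k n)\<^sup>2) * y n t) (at t within {0..\<tau>})"
    using ysol unfolding sol_def by (blast, metis atLeastAtMost_iff order_trans)
  define M where "M \<tau> n = (cmod (coord w0 n))\<^sup>2 + integral {0..\<tau>} (\<lambda>s. (cmod (coord (h s) n))\<^sup>2) / \<nu>" for \<tau> n
  have h': "continuous_on {0..\<tau>} h" for \<tau> by (rule continuous_on_subset[OF h]) auto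
  have int: "(\<lambda>s. (cmod (coord (h s) n))\<^sup>2) integrable_on {0..\<tau>}" for n \<tau>
    by (intro integrable_continuous_real continuous_intros h')
  have yM: "(cmod (y n t))\<^sup>2 \<le> M \<tau> n" if "0 \<le> t" "t \<le> \<tau>" for n t \<tau>
  proof -
    have "(\<lambda>s. (k n)\<^sup>2 * (cmod (y n s))\<^sup>2) integrable_on {0..t}"
      using y[of _ t n] by (intro integrable_continuous_real continuous_intros)
        (meson continuous_on_eq_continuous_within has_vector_derivative_continuous)
    then have "0 \<le> \<nu> * integral {0..t} (\<lambda>s. (k n)\<^sup>2 * (cmod (y n s))\<^sup>2)"
      using \<nu> by (intro mult_nonneg_nonneg integral_nonneg) simp_all
    moreover have "(cmod (y n t))\<^sup>2 + \<nu> * integral {0..t} (\<lambda>s. (k n)\<^sup>2 * (cmod (y n s))\<^sup>2)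
        \<le> (cmod (y n 0))\<^sup>2 + integral {0..t} (\<lambda>s. (cmod (coord (h s) n))\<^sup>2) / \<nu>"
      by (rule coordinate_energy_estimate[OF y h' that(1)])
    moreover have "integral {0..t} (\<lambda>s. (cmod (coord (h s) n))\<^sup>2) / \<nu>
        \<le> integral {0..\<tau>} (\<lambda>s. (cmod (coord (h s) n))\<^sup>2) / \<nu>"
      using \<nu> that by (intro divide_right_mono integral_subset_le int) auto
    ultimately show ?thesis by (simp add: M_def y0)
  qed
  have sumM: "(\<Sum>n<m. M \<tau> n) \<le> (norm w0)\<^sup>2 + integral {0..\<tau>} (\<lambda>s. (norm (h s))\<^sup>2) / \<nu>" for m \<tau>
    using \<nu> unfolding M_def sum.distrib sum_divide_distrib[symmetric]
    by (intro add_mono divide_right_mono sum_coord_le_norm sum_integral_coord_le h') simp_all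
  have M_nonneg: "0 \<le> M \<tau> n" for \<tau> n
    using \<nu> unfolding M_def by (intro add_nonneg_nonneg divide_nonneg_pos integral_nonneg int) simp_all
  have "summable (M \<tau>)" for \<tau>
    by (rule summable_if_partial_sums_le[OF M_nonneg sumM])
  define w where "w t = Ell2 (\<lambda>n. y n t)" for t
  have w: "coord (w t) n = y n t" if "t \<ge> 0" for t n
  proof -
    have "y 0 t = 0" using yM[OF that order_refl, of 0] by (simp add: M_def)
    moreover have "(\<Sum>n<m. (cmod (y n t))\<^sup>2) \<le> (norm w0)\<^sup>2 + integral {0..t} (\<lambda>s. (norm (h s))\<^sup>2) / \<nu>" for m
      by (rule order_trans[OF sum_mono[OF yM[OF that order_refl]] sumM])
    ultimately show ?thesis unfolding w_def by (subst coord_Ell2) simp_all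
  qed
  have "evolves h w \<tau>" if "\<tau> \<ge> 0" for \<tau>
    unfolding evolves_def
  proof (intro conjI allI ballI)
    show d: "((\<lambda>s. coord (w s) n) has_vector_derivative
        of_real (k n) * coord (h t) n - of_real (\<nu> * (k n)\<^sup>2) * coord (w t) n) (at t within {0..\<tau>})"
      if "t \<in> {0..\<tau>}" for n t
      using y[OF that, of n] that w by (subst has_vector_derivative_transform[of _ _ _ "y n"]) auto
    show "continuous_on {0..\<tau>} w"
    proof (rule continuous_on_if_coord_dominated)
      show "continuous_on {0..\<tau>} (\<lambda>t. coord (w t) n)" for n
        using d continuous_on_eq_continuous_within has_vector_derivative_continuous by blast
    qed (use yM w \<open>summable (M \<tau>)\<close> in auto)
  qed
  moreover have "w 0 = w0" by (rule ell2_eqI) (simp add: w y0)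
  ultimately show ?thesis by blast
qed

section \<open>Semilinear equations with a Lipschitz nonlinearity\<close>

text \<open>The energy estimate, with a weight \<open>exp (- K t)\<close> whose rate \<open>K\<close> is large compared with the
  Lipschitz constant \<open>\<Lambda>\<close>, makes the solution operator a contraction. This yields uniqueness as well
  as existence for all times.\<close>

definition weight :: "real \<Rightarrow> real" where
  "weight \<Lambda> = 2 * \<Lambda>\<^sup>2 / \<nu> + 1"

lemma weight_pos [simp]: "weight \<Lambda> > 0" "weight \<Lambda> \<ge> 0"
  using \<nu> by (simp_all add: weight_def add_nonneg_pos)

lemma integral_exp_bound_le:
  assumes h: "continuous_on {0..\<tau>} h" and \<tau>: "\<tau> \<ge> 0"
    and le: "\<And>s. s \<in> {0..\<tau>} \<Longrightarrow> norm (h s) \<le> R * exp (weight \<Lambda> * s)"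
  shows "integral {0..\<tau>} (\<lambda>s. (norm (h s))\<^sup>2) / \<nu>
    \<le> (R * exp (weight \<Lambda> * \<tau>))\<^sup>2 / (\<nu> * (2 * weight \<Lambda>))"
proof -
  have "integral {0..\<tau>} (\<lambda>s. (norm (h s))\<^sup>2) \<le> integral {0..\<tau>} (\<lambda>s. R\<^sup>2 * exp (2 * weight \<Lambda> * s))"
  proof (intro integral_le integrable_continuous_real continuous_intros h)
    fix s assume "s \<in> {0..\<tau>}"
    from power_mono[OF le[OF this] norm_ge_zero, of 2]
    show "(norm (h s))\<^sup>2 \<le> R\<^sup>2 * exp (2 * weight \<Lambda> * s)"
      by (simp add: power_mult_distrib exp_double mult.assoc)
  qed
  also have "\<dots> \<le> R\<^sup>2 * (exp (2 * weight \<Lambda> * \<tau>) / (2 * weight \<Lambda>))"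
    unfolding integral_mult_right by (intro mult_left_mono integral_exp_le \<tau>) simp_all
  also have "exp (2 * weight \<Lambda> * \<tau>) = (exp (weight \<Lambda> * \<tau>))\<^sup>2"
    by (simp add: exp_double mult.assoc)
  finally have "integral {0..\<tau>} (\<lambda>s. (norm (h s))\<^sup>2) / \<nu>
      \<le> R\<^sup>2 * ((exp (weight \<Lambda> * \<tau>))\<^sup>2 / (2 * weight \<Lambda>)) / \<nu>"
    using \<nu> by (intro divide_right_mono) simp_all
  then show ?thesis by (simp add: power_mult_distrib mult.commute[of \<nu>])
qed

lemma weighted_contraction:
  assumes d: "evolves h d \<tau>" "d 0 = 0" and h: "continuous_on {0..\<tau>} h" and \<tau>: "\<tau> \<ge> 0" and M: "M \<ge> 0"
    and le: "\<And>s. s \<in> {0..\<tau>} \<Longrightarrow> norm (h s) \<le> \<Lambda> * M * exp (weight \<Lambda> * s)"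
  shows "norm (d \<tau>) \<le> exp (weight \<Lambda> * \<tau>) * M / 2"
proof -
  have "(norm (d \<tau>))\<^sup>2 \<le> (\<Lambda> * M * exp (weight \<Lambda> * \<tau>))\<^sup>2 / (\<nu> * (2 * weight \<Lambda>))"
    using norm_energy_estimate[OF d(1) h \<tau>] integral_exp_bound_le[OF h \<tau> le] d(2) by simp
  also have "\<dots> = (exp (weight \<Lambda> * \<tau>) * M)\<^sup>2 * (\<Lambda>\<^sup>2 / (\<nu> * (2 * weight \<Lambda>)))"
    by (simp add: power_mult_distrib)
  also have "\<dots> \<le> (exp (weight \<Lambda> * \<tau>) * M)\<^sup>2 * (1 / 4)"
  proof (rule mult_left_mono)
    have "4 * \<Lambda>\<^sup>2 \<le> \<nu> * (2 * weight \<Lambda>)" using \<nu> by (simp add: weight_def field_simps)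
    then show "\<Lambda>\<^sup>2 / (\<nu> * (2 * weight \<Lambda>)) \<le> 1 / 4" using \<nu> by (simp add: divide_simps)
  qed simp
  also have "\<dots> = (exp (weight \<Lambda> * \<tau>) * M / 2)\<^sup>2" by (simp add: power_divide)
  finally show ?thesis
    using M by (simp add: power2_le_iff_abs_le)
qed

text \<open>At a point where the weighted distance of two solutions is maximal, the contraction bounds it by
  half of itself.\<close>

lemma semilinear_solution_unique:
  assumes F: "\<Lambda>-lipschitz_on UNIV F"
    and w: "evolves (\<lambda>s. F (w s)) w \<tau>" and v: "evolves (\<lambda>s. F (v s)) v \<tau>"
    and init: "w 0 = v 0" and t: "t \<in> {0..\<tau>}"
  shows "w t = v t"
proof -
  define g where "g s = exp (- weight \<Lambda> * s) * norm (w s - v s)" for s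
  have wv: "continuous_on {0..\<tau>} w" "continuous_on {0..\<tau>} v"
    using w v by (simp_all add: evolves_def)
  have contF: "continuous_on UNIV F"
    by (rule lipschitz_on_continuous_on[OF F])
  have "continuous_on {0..\<tau>} g" unfolding g_def by (intro continuous_intros wv)
  then obtain \<sigma> where \<sigma>: "\<sigma> \<in> {0..\<tau>}" and max: "\<And>s. s \<in> {0..\<tau>} \<Longrightarrow> g s \<le> g \<sigma>"
    using continuous_attains_sup[of "{0..\<tau>}" g] t by auto
  have g_le: "norm (w s - v s) = exp (weight \<Lambda> * s) * g s" for s
    by (simp add: g_def exp_minus)
  have "norm (w \<sigma> - v \<sigma>) \<le> exp (weight \<Lambda> * \<sigma>) * g \<sigma> / 2"
  proof (rule weighted_contraction)
    show "evolves (\<lambda>s. F (w s) - F (v s)) (\<lambda>s. w s - v s) \<sigma>"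
      using evolves_diff[OF w v] \<sigma> by (auto intro: evolves_subinterval)
    show "continuous_on {0..\<sigma>} (\<lambda>s. F (w s) - F (v s))"
      using \<sigma> by (intro continuous_intros continuous_on_compose2[OF contF] continuous_on_subset[OF wv(1)]
        continuous_on_subset[OF wv(2)]) auto
    fix s assume "s \<in> {0..\<sigma>}"
    then have s: "s \<in> {0..\<tau>}" using \<sigma> by auto
    have "norm (F (w s) - F (v s)) \<le> \<Lambda> * norm (w s - v s)"
      using lipschitz_onD[OF F] by (simp add: dist_norm)
    also have "\<dots> = \<Lambda> * (exp (weight \<Lambda> * s) * g s)" by (simp only: g_le)
    also have "\<dots> \<le> \<Lambda> * (exp (weight \<Lambda> * s) * g \<sigma>)"
      using lipschitz_on_nonneg[OF F] max[OF s] by (intro mult_left_mono) simp_all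
    finally show "norm (F (w s) - F (v s)) \<le> \<Lambda> * g \<sigma> * exp (weight \<Lambda> * s)"
      by (simp add: mult_ac)
  qed (use \<sigma> init in \<open>auto simp: g_def\<close>)
  then have "exp (weight \<Lambda> * \<sigma>) * g \<sigma> \<le> exp (weight \<Lambda> * \<sigma>) * (g \<sigma> / 2)"
    by (simp add: g_le)
  then have "g \<sigma> \<le> 0" by simp
  then have "g t \<le> 0" using max[OF t] by simp
  then show ?thesis by (simp add: g_def mult_le_0_iff)
qed

lemma semilinear_solution_exists:
  assumes F: "\<Lambda>-lipschitz_on UNIV F"
  shows "\<exists>w. w 0 = w0 \<and> (\<forall>\<tau>\<ge>0. evolves (\<lambda>s. F (w s)) w \<tau>)"
proof -
  let ?K = "weight \<Lambda>"
  have \<Lambda>: "\<Lambda> \<ge> 0" by (rule lipschitz_on_nonneg[OF F])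
  \<comment> \<open>The unknown is \<open>y t = exp (- K t) *\<^sub>R w t\<close>, which is bounded on the half line.\<close>
  define h where "h y s = F (exp (?K * s) *\<^sub>R apply_bcontfun y s)" for y s
  have ch: "continuous_on S (h y)" for S y
    unfolding h_def by (intro continuous_on_compose2[OF lipschitz_on_continuous_on[OF F]] continuous_intros) auto
  have "\<forall>y. \<exists>w. w 0 = w0 \<and> (\<forall>\<tau>\<ge>0. evolves (h y) w \<tau>)"
    by (intro allI forced_solution_exists ch)
  from choice[OF this] obtain S where S0: "\<And>y. S y 0 = w0"
    and S: "\<And>y \<tau>. \<tau> \<ge> 0 \<Longrightarrow> evolves (h y) (S y) \<tau>"
    by blast
  \<comment> \<open>Negative times are mapped to 0, since the bounded continuous functions live on the whole line.\<close>
  define \<Psi> where "\<Psi> y t = exp (- ?K * max 0 t) *\<^sub>R S y (max 0 t)" for y t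
  have \<Psi>: "\<Psi> y \<in> bcontfun" for y
  proof (rule bcontfun_normI)
    have "continuous_on {0..} (S y)"
      using S by (intro continuous_on_half_line) (simp add: evolves_def)
    then have "continuous_on UNIV (\<lambda>t::real. S y (max 0 t))"
      by (rule continuous_on_compose2) (auto intro!: continuous_intros)
    then show "continuous_on UNIV (\<Psi> y)"
      unfolding \<Psi>_def by (intro continuous_intros)
    define R where "R = norm (F 0) + \<Lambda> * norm y"
    have R: "norm (h y s) \<le> R * exp (?K * s)" if "s \<ge> 0" for s
    proof -
      have "norm (h y s) \<le> norm (F 0) + \<Lambda> * norm (exp (?K * s) *\<^sub>R apply_bcontfun y s)"
        using lipschitz_onD[OF F, of "exp (?K * s) *\<^sub>R apply_bcontfun y s" 0] norm_triangle_sub[of "h y s" "F 0"]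
        by (simp add: h_def dist_norm)
      also have "\<dots> \<le> norm (F 0) * exp (?K * s) + \<Lambda> * (exp (?K * s) * norm y)"
        using that \<Lambda> norm_bounded[of y s] by (intro add_mono mult_left_mono) (simp_all add: mult_le_cancel_left1)
      finally show ?thesis by (simp add: R_def algebra_simps)
    qed
    fix t :: real
    let ?t = "max 0 t" and ?Q = "(norm w0)\<^sup>2 + R\<^sup>2 / (\<nu> * (2 * ?K))"
    have t: "0 \<le> ?t" by simp
    have "(norm (S y ?t))\<^sup>2 \<le> (norm (S y 0))\<^sup>2 + integral {0..?t} (\<lambda>s. (norm (h y s))\<^sup>2) / \<nu>"
      by (rule norm_energy_estimate[OF S[OF t] ch t])
    also have "\<dots> \<le> (norm w0)\<^sup>2 + (R * exp (?K * ?t))\<^sup>2 / (\<nu> * (2 * ?K))"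
      by (intro add_mono integral_exp_bound_le ch t R) (simp_all add: S0)
    also have "\<dots> \<le> (exp (?K * ?t))\<^sup>2 * (norm w0)\<^sup>2 + (exp (?K * ?t))\<^sup>2 * (R\<^sup>2 / (\<nu> * (2 * ?K)))"
    proof (rule add_mono)
      have "1 \<le> (exp (?K * ?t))\<^sup>2" by (simp add: one_le_power)
      then show "(norm w0)\<^sup>2 \<le> (exp (?K * ?t))\<^sup>2 * (norm w0)\<^sup>2"
        using mult_right_mono[of 1 "(exp (?K * ?t))\<^sup>2" "(norm w0)\<^sup>2"] by simp
    qed (simp add: power_mult_distrib mult.commute)
    also have "\<dots> = (exp (?K * ?t) * sqrt ?Q)\<^sup>2"
      using \<nu> by (simp add: power_mult_distrib distrib_left)
    finally have "norm (S y ?t) \<le> exp (?K * ?t) * sqrt ?Q"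
      by (rule power2_le_imp_le) (use \<nu> in simp)
    then show "norm (\<Psi> y t) \<le> sqrt ?Q"
      by (simp add: \<Psi>_def exp_minus field_simps)
  qed
  have "dist (Bcontfun (\<Psi> y)) (Bcontfun (\<Psi> z)) \<le> 1/2 * dist y z" for y z
  proof (rule dist_bound)
    fix t :: real
    let ?t = "max 0 t"
    have "norm (S y ?t - S z ?t) \<le> exp (?K * ?t) * dist y z / 2"
    proof (rule weighted_contraction)
      show "evolves (\<lambda>s. h y s - h z s) (\<lambda>s. S y s - S z s) ?t"
        by (intro evolves_diff S) simp_all
      fix s :: real assume "s \<in> {0..?t}"
      have "norm (h y s - h z s) \<le> \<Lambda> * norm (exp (?K * s) *\<^sub>R (apply_bcontfun y s - apply_bcontfun z s))"
        using lipschitz_onD[OF F, of "exp (?K * s) *\<^sub>R apply_bcontfun y s" "exp (?K * s) *\<^sub>R apply_bcontfun z s"]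
        by (simp add: h_def dist_norm scaleR_diff_right)
      also have "\<dots> \<le> \<Lambda> * (exp (?K * s) * dist y z)"
        using \<Lambda> dist_bounded[of y s z] by (intro mult_left_mono) (simp_all add: dist_norm)
      finally show "norm (h y s - h z s) \<le> \<Lambda> * dist y z * exp (?K * s)"
        by (simp add: mult_ac)
    qed (auto simp: S0 intro!: continuous_intros ch)
    then show "dist (apply_bcontfun (Bcontfun (\<Psi> y)) t) (apply_bcontfun (Bcontfun (\<Psi> z)) t) \<le> 1/2 * dist y z"
      unfolding Bcontfun_inverse[OF \<Psi>] \<Psi>_def dist_norm scaleR_diff_right[symmetric] norm_scaleR
      by (simp add: exp_minus divide_simps mult_ac)
  qed
  then obtain y where y: "Bcontfun (\<Psi> y) = y"
    using banach_fix_type[of "1/2" "\<lambda>y. Bcontfun (\<Psi> y)"] by auto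
  have "h y s = F (S y s)" if "s \<ge> 0" for s
  proof -
    have "apply_bcontfun y s = exp (- ?K * s) *\<^sub>R S y s"
      using arg_cong[OF y, of apply_bcontfun] that by (simp add: Bcontfun_inverse[OF \<Psi>] fun_eq_iff \<Psi>_def)
        (metis max.absorb2)
    then show ?thesis by (simp add: h_def exp_minus)
  qed
  then have "evolves (\<lambda>s. F (S y s)) (S y) \<tau>" if "\<tau> \<ge> 0" for \<tau>
    using S[OF that, of y] by (simp add: evolves_def)
  then show ?thesis using S0 by blast
qed

end

section \<open>The feedback system around the steady state\<close>

text \<open>The form is nonnegative at \<open>u - R u / c\<close>, the choice that minimizes the resulting bound.\<close>

lemma norm_le_if_quadratic_form_le:
  fixes R :: "'a::real_inner \<Rightarrow> 'a"
  assumes R: "linear R" and sym: "\<And>u v. R u \<bullet> v = u \<bullet> R v" and c: "c > 0"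
    and nonneg: "\<And>u. 0 \<le> R u \<bullet> u" and le: "\<And>u. R u \<bullet> u \<le> c * (norm u)\<^sup>2"
  shows "norm (R u) \<le> c * norm u"
proof -
  let ?v = "u - (1 / c) *\<^sub>R R u"
  have "0 \<le> R ?v \<bullet> ?v" by (rule nonneg)
  also have "\<dots> = R u \<bullet> u - 2 * (norm (R u))\<^sup>2 / c + (R (R u) \<bullet> R u) / c\<^sup>2"
    unfolding power2_norm_eq_inner using sym[of "R u" u] c
    by (simp add: linear_diff[OF R] linear_scale[OF R] inner_diff_left inner_diff_right
      power2_eq_square field_simps)
  also have "\<dots> \<le> c * (norm u)\<^sup>2 - 2 * (norm (R u))\<^sup>2 / c + (c * (norm (R u))\<^sup>2) / c\<^sup>2"
    by (intro add_mono diff_mono divide_right_mono le) (use c in simp_all)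
  also have "\<dots> = ((c * norm u)\<^sup>2 - (norm (R u))\<^sup>2) / c"
    using c by (simp add: power2_eq_square field_simps)
  finally have "(norm (R u))\<^sup>2 \<le> (c * norm u)\<^sup>2"
    using c by (simp add: zero_le_divide_iff)
  then show ?thesis by (rule power2_le_imp_le) (use c in simp)
qed

text \<open>The radial projection to the ball of radius \<open>r\<close>. The Lipschitz constant 2 below holds in every normed
  space.\<close>

definition clip :: "real \<Rightarrow> 'a::real_normed_vector \<Rightarrow> 'a" where
  "clip r u = (r / max r (norm u)) *\<^sub>R u"

lemma clip_eq: "r > 0 \<Longrightarrow> norm u \<le> r \<Longrightarrow> clip r u = u"
  by (simp add: clip_def)

lemma norm_clip_le: "r > 0 \<Longrightarrow> norm (clip r u) \<le> r"
  by (simp add: clip_def divide_le_eq)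

lemma norm_clip_diff_le:
  assumes r: "r > 0"
  shows "norm (clip r u - clip r v) \<le> 2 * norm (u - v)"
proof -
  define p q where "p = max r (norm u)" and "q = max r (norm v)"
  have pq: "p > 0" "q > 0" "r \<le> p" "norm v \<le> q" using r by (auto simp: p_def q_def)
  have "\<bar>q - p\<bar> \<le> norm (u - v)"
    using norm_triangle_ineq3[of u v] by (auto simp: p_def q_def)
  have "clip r u - clip r v = (r / p) *\<^sub>R (u - v) + (r / p - r / q) *\<^sub>R v"
    by (simp add: clip_def p_def q_def algebra_simps)
  moreover have "norm ((r / p) *\<^sub>R (u - v)) \<le> norm (u - v)"
    using pq r mult_right_mono[of "r / p" 1 "norm (u - v)"] by simp
  moreover have "norm ((r / p - r / q) *\<^sub>R v) \<le> norm (u - v)"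
  proof -
    have "r / p - r / q = (r / p) * ((q - p) / q)" using pq by (simp add: field_simps)
    then have "norm ((r / p - r / q) *\<^sub>R v) = (r / p) * (norm v / q) * \<bar>q - p\<bar>"
      using pq r by (simp add: abs_mult)
    also have "\<dots> \<le> 1 * 1 * norm (u - v)"
      using pq r \<open>\<bar>q - p\<bar> \<le> norm (u - v)\<close> by (intro mult_mono) simp_all
    finally show ?thesis by simp
  qed
  ultimately show ?thesis
    using norm_triangle_ineq[of "(r / p) *\<^sub>R (u - v)" "(r / p - r / q) *\<^sub>R v"] by simp
qed

locale riccati_feedback_system = shell_model +
  fixes \<beta> b1 b2 :: real and f :: "nat \<Rightarrow> complex" and ue :: ell2 and R0 B1 :: "ell2 \<Rightarrow> ell2"
    and \<phi>s :: "nat \<Rightarrow> ell2" and N :: nat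
  assumes \<beta>: "\<beta> > 0" and b12: "b1 > 0" "b2 > 0"
    and ue: "ue \<in> V_space k"
    and steady: "\<And>n. of_real \<nu> * A_pow_seq k 1 ue n + B_seq k a b ue ue n = f n"
    and R0_linear: "linear R0" and R0_sym: "\<And>u v. R0 u \<bullet> v = u \<bullet> R0 v"
    and R0_lower: "\<And>u. b1 * (norm u)\<^sup>2 \<le> R0 u \<bullet> u" and R0_upper: "\<And>u. R0 u \<bullet> u \<le> b2 * (norm u)\<^sup>2"
    and riccati: "riccati_equation k (lin_op k \<nu> a b ue) \<beta> N B1 \<phi>s R0"
begin

lemma norm_R0_le: "norm (R0 u) \<le> b2 * norm u"
proof (rule norm_le_if_quadratic_form_le[OF R0_linear R0_sym b12(2) _ R0_upper])
  show "0 \<le> R0 u \<bullet> u" for u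
    using R0_lower[of u] b12 by (meson order_trans zero_le_power2 mult_nonneg_nonneg less_imp_le)
qed

lemma bounded_linear_R0: "bounded_linear R0"
  using norm_R0_le linear_add[OF R0_linear] linear_scale[OF R0_linear]
  by (intro bounded_linear_intro[of _ b2]) (simp_all add: mult.commute)

definition feedback :: "ell2 \<Rightarrow> ell2" where
  "feedback u = (\<Sum>j=1..N. cinner (R0 u) (B1 (\<phi>s j)) *\<^sub>C B1 (\<phi>s j))"

lemma bounded_linear_feedback: "bounded_linear feedback"
  unfolding feedback_def
  by (intro bounded_linear_sum bounded_linear_compose[OF bounded_linear_cscale_left]
    bounded_linear_compose[OF bounded_linear_cinner_left] bounded_linear_R0)

text \<open>All zeroth order terms of the equation for the deviation from the steady state.\<close>

definition drift :: "ell2 \<Rightarrow> ell2" where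
  "drift u = B_linearized ue u + feedback u"

lemma ue_coord_bounded: "k j * cmod (coord ue j) \<le> V_norm k ue"
  by (rule V_coord_bounded[OF ue])

lemmas coord_B_linearized_ue = coord_B_linearized[OF ue_coord_bounded]

lemma bounded_linear_drift: "bounded_linear drift"
  unfolding drift_def
  by (intro bounded_linear_add bounded_linear_B_linearized[OF ue_coord_bounded] bounded_linear_feedback)

text \<open>The equation for the deviation \<open>w\<close> is \<open>w' + \<nu> A w = A\<^sup>1\<^sup>/\<^sup>2 (forcing r w)\<close> as long as
  \<open>norm w \<le> r\<close>. Clipping the argument of the quadratic term makes the right hand side globally
  Lipschitz.\<close>

definition forcing :: "real \<Rightarrow> ell2 \<Rightarrow> ell2" where
  "forcing r w = - (diag (\<lambda>n. 1 / k n) (drift w) + weak_B (clip r w) (clip r w))"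

lemma forcing_lipschitz:
  assumes r: "r > 0"
  shows "\<exists>\<Lambda>. \<Lambda>-lipschitz_on UNIV (forcing r)"
proof -
  interpret weak_B: bounded_bilinear weak_B by (rule bounded_bilinear_weak_B)
  define D where "D u = diag (\<lambda>n. 1 / k n) (drift u)" for u
  have D: "bounded_linear D"
    unfolding D_def by (rule bounded_linear_compose[OF bounded_linear_A_inv_half bounded_linear_drift])
  obtain c where c: "\<And>u. norm (D u) \<le> norm u * c" "c \<ge> 0"
    using bounded_linear.nonneg_bounded[OF D] by blast
  obtain K where K: "\<And>u v. norm (weak_B u v) \<le> norm u * norm v * K" "K \<ge> 0"
    using weak_B.nonneg_bounded by blast
  have "norm (forcing r u - forcing r v) \<le> (c + 4 * r * K) * norm (u - v)" for u v
  proof -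
    let ?u = "clip r u" and ?v = "clip r v"
    have "forcing r u - forcing r v = - (D (u - v) + (weak_B (?u - ?v) ?u + weak_B ?v (?u - ?v)))"
      by (simp add: forcing_def D_def[symmetric] linear_diff[OF bounded_linear.linear[OF D]]
        weak_B.diff_left weak_B.diff_right)
    then have "norm (forcing r u - forcing r v)
        \<le> norm (D (u - v)) + (norm (weak_B (?u - ?v) ?u) + norm (weak_B ?v (?u - ?v)))"
      by (simp only: norm_minus_cancel) (meson norm_triangle_le norm_triangle_ineq add_left_mono order_trans)
    also have "\<dots> \<le> norm (u - v) * c + (2 * norm (u - v) * r * K + r * (2 * norm (u - v)) * K)"
      using norm_clip_diff_le[OF r, of u v] norm_clip_le[OF r] K(2) r
      by (intro add_mono c order_trans[OF K(1)] mult_right_mono mult_mono) simp_all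
    finally show ?thesis by (simp add: algebra_simps)
  qed
  then show ?thesis
    using c K r by (intro exI[of _ "c + 4 * r * K"] lipschitz_onI) (simp_all add: dist_norm)
qed

lemma continuous_on_forcing:
  assumes r: "r > 0" and w: "continuous_on S w"
  shows "continuous_on S (\<lambda>s. forcing r (w s))"
proof -
  obtain \<Lambda> where "\<Lambda>-lipschitz_on UNIV (forcing r)"
    using forcing_lipschitz[OF r] by blast
  then have "continuous_on UNIV (forcing r)" by (rule lipschitz_on_continuous_on)
  then show ?thesis by (rule continuous_on_compose2[OF _ w subset_UNIV])
qed

lemma coord_forcing:
  assumes "r > 0" "norm w \<le> r"
  shows "of_real (k n) * coord (forcing r w) n - of_real (\<nu> * (k n)\<^sup>2) * coord w n
    = f n - coord (feedback w) n - of_real \<nu> * A_pow_seq k 1 (ue + w) n - B_seq k a b (ue + w) (ue + w) n"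
proof -
  have "of_real (k n) * coord (forcing r w) n = - (coord (drift w) n + B_seq k a b w w n)"
    using assms by (simp add: forcing_def clip_eq coord_A_inv_half coord_weak_B field_simps)
  moreover have "coord (drift w) n = B_seq k a b w ue n + B_seq k a b ue w n + coord (feedback w) n"
    by (simp add: drift_def coord_B_linearized_ue)
  moreover have "f n = of_real \<nu> * A_pow_seq k 1 ue n + B_seq k a b ue ue n"
    using steady by simp
  ultimately show ?thesis
    by (simp add: B_seq_add_left B_seq_add_right A_pow_seq_one algebra_simps)
qed

section \<open>The Lyapunov function\<close>

text \<open>The Riccati equation leaves the squared coefficients with a positive sign; the feedback contributes
  twice their sum with a negative sign.\<close>

lemma riccati_dissipation:
  assumes u: "u \<in> dom_A_pow k 1"
  shows "- 2 * ((lin_op k \<nu> a b ue u + feedback u) \<bullet> R0 u)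
    \<le> - 2 * \<beta> * (u \<bullet> R0 u) - (norm (A_pow k (1/2) u))\<^sup>2"
proof -
  let ?\<sigma> = "\<Sum>j=1..N. (cmod (cinner (B1 (\<phi>s j)) (R0 u)))\<^sup>2"
  have "(cinner x h *\<^sub>C h) \<bullet> x = (cmod (cinner h x))\<^sup>2" for x h
    using cinner_commute[of x h]
    by (simp add: inner_ell2_def cinner_cscale_left mult.commute[of "cnj _"] complex_norm_square[symmetric]
      del: of_real_power)
  then have "feedback u \<bullet> R0 u = ?\<sigma>"
    by (simp add: feedback_def inner_sum_left)
  moreover have "(lin_op k \<nu> a b ue u - \<beta> *\<^sub>R u) \<bullet> R0 u + 1/2 * ?\<sigma> = 1/2 * (norm (A_pow k (1/2) u))\<^sup>2"
    using riccati u unfolding riccati_equation_def by blast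
  moreover have "?\<sigma> \<ge> 0" by (intro sum_nonneg) simp
  ultimately show ?thesis by (simp add: inner_add_left inner_diff_left)
qed

text \<open>The commutator of truncation and \<open>drift\<close>. As \<open>A\<close> commutes with the truncation, this is the only
  error in the linear part of the equation for \<open>trunc m w\<close>.\<close>

definition residual :: "nat \<Rightarrow> ell2 \<Rightarrow> ell2" where
  "residual m w = trunc m (drift w) - drift (trunc m w)"

lemma residual_tendsto: "(\<lambda>m. residual m w) \<longlonglongrightarrow> 0"
proof -
  have "(\<lambda>m. residual m w) \<longlonglongrightarrow> drift w - drift w"
    unfolding residual_def
    by (intro tendsto_diff trunc_tendsto bounded_linear.tendsto[OF bounded_linear_drift])
  then show ?thesis by simp
qed

lemma residual_bounded: "\<exists>c\<ge>0. \<forall>m w. norm (residual m w) \<le> c * norm w"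
proof -
  obtain c where c: "\<And>u. norm (drift u) \<le> norm u * c" "c \<ge> 0"
    using bounded_linear.nonneg_bounded[OF bounded_linear_drift] by blast
  have "norm (residual m w) \<le> 2 * c * norm w" for m w
  proof -
    have "norm (residual m w) \<le> norm (trunc m (drift w)) + norm (drift (trunc m w))"
      unfolding residual_def by (rule norm_triangle_ineq4)
    also have "\<dots> \<le> norm w * c + norm w * c"
      by (rule add_mono[OF order_trans[OF norm_trunc_le c(1)]
            order_trans[OF c(1) mult_right_mono[OF norm_trunc_le c(2)]]])
    finally show ?thesis by simp
  qed
  then show ?thesis using c(2) by (intro exI[of _ "2 * c"]) simp
qed

text \<open>The constant is such that \<open>16 (|a| + |b|) b2 radius / k0 \<le> 1/2\<close>, as needed in
  \<open>quadratic_term_le\<close>.\<close>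

definition radius :: real where
  "radius = k0 / (32 * b2 * (\<bar>a\<bar> + \<bar>b\<bar> + 1))"

lemma radius_pos: "radius > 0"
  using k0 b12 by (simp add: radius_def)

lemma norm_diag_cut_k_mono: "m \<le> l \<Longrightarrow> norm (diag (cut m k) u) \<le> norm (diag (cut l k) u)"
  by (rule power2_le_imp_le) (auto simp: norm_diag_cut_square intro!: sum_mono2)

text \<open>Clipping bounds one factor of the quadratic term by \<open>radius\<close>, whatever the size of \<open>w\<close>; the other
  factor and \<open>trunc m w\<close> are both estimated in \<open>V\<close>. Hence the dissipation of the Riccati equation absorbs
  the quadratic term.\<close>

lemma quadratic_term_le:
  "2 * norm (diag (cut m k) (weak_B (clip radius w) (clip radius w))) * (b2 * norm (trunc m w))
    \<le> (norm (diag (cut (m + 2) k) w))\<^sup>2 / 2"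
proof -
  let ?X = "norm (diag (cut (m + 2) k) w)" and ?c = "clip radius w"
  have "k0 * norm (trunc m w) \<le> norm (diag (cut m k) w)"
  proof (rule power2_le_imp_le)
    show "(k0 * norm (trunc m w))\<^sup>2 \<le> (norm (diag (cut m k) w))\<^sup>2"
      unfolding power_mult_distrib norm_diag_cut_square sum_distrib_left
      using k0 k0_le_k by (intro sum_mono) (simp add: mult_right_mono power_mono)
  qed simp
  also have "\<dots> \<le> ?X" by (rule norm_diag_cut_k_mono) simp
  finally have W: "norm (trunc m w) \<le> ?X / k0"
    using k0 by (simp add: field_simps)
  have "norm (diag (cut (m + 2) k) ?c) \<le> ?X"
  proof -
    have "diag (cut (m + 2) k) ?c = (radius / max radius (norm w)) *\<^sub>R diag (cut (m + 2) k) w"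
      unfolding clip_def by (rule linear_scale[OF bounded_linear.linear[OF bounded_linear_diag_cut]])
    then show ?thesis
      using radius_pos mult_right_mono[of "radius / max radius (norm w)" 1 ?X] by simp
  qed
  then have "norm (diag (cut m k) (weak_B ?c ?c)) \<le> 8 * (\<bar>a\<bar> + \<bar>b\<bar>) * radius * ?X"
    using norm_clip_le[OF radius_pos, of w]
    by (intro order_trans[OF norm_trunc_B_le] mult_mono mult_left_mono) (simp_all add: radius_pos less_imp_le)
  then have "2 * norm (diag (cut m k) (weak_B ?c ?c)) * (b2 * norm (trunc m w))
      \<le> 2 * (8 * (\<bar>a\<bar> + \<bar>b\<bar>) * radius * ?X) * (b2 * (?X / k0))"
    using W b12 radius_pos by (intro mult_mono) simp_all
  also have "\<dots> = (\<bar>a\<bar> + \<bar>b\<bar>) / (\<bar>a\<bar> + \<bar>b\<bar> + 1) * (?X\<^sup>2 / 2)"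
  proof -
    have alg: "2 * (8 * p * (k0 / (32 * b2 * n)) * x) * (b2 * (x / k0)) = p / n * (x\<^sup>2 / 2)"
      if "n > 0" for p n x :: real
      using that b12 k0 by (simp add: field_simps power2_eq_square)
    show ?thesis unfolding radius_def by (rule alg) linarith
  qed
  also have "\<dots> \<le> ?X\<^sup>2 / 2"
    by (intro mult_left_le_one_le) (simp_all add: divide_le_eq_1 add_nonneg_pos)
  finally show ?thesis .
qed

text \<open>\<open>trunc m (w t)\<close> lies in \<open>D(A)\<close>, so the Riccati equation applies to it.\<close>

lemma lyapunov_derivative:
  assumes w: "evolves (\<lambda>s. forcing radius (w s)) w \<tau>" and t: "t \<in> {0..\<tau>}"
  shows "\<exists>E'. ((\<lambda>s. trunc m (w s) \<bullet> R0 (trunc m (w s))) has_vector_derivative E') (at t within {0..\<tau>}) \<and>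
    E' \<le> - 2 * \<beta> * (trunc m (w t) \<bullet> R0 (trunc m (w t))) - (norm (diag (cut m k) (w t)))\<^sup>2
       + (norm (diag (cut (m + 2) k) (w t)))\<^sup>2 / 2 + 2 * b2 * norm (w t) * norm (residual m (w t))"
proof -
  let ?W = "trunc m (w t)" and ?c = "clip radius (w t)"
  let ?Q = "diag (cut m k) (weak_B ?c ?c)"
  \<comment> \<open>The time derivative, arranged so that the linear operators act on the truncated state.\<close>
  define D where "D = - (lin_op k \<nu> a b ue ?W + feedback ?W + residual m (w t) + ?Q)"
  have L: "lin_op k \<nu> a b ue ?W = \<nu> *\<^sub>R diag (cut m (\<lambda>n. (k n)\<^sup>2)) (w t) + B_linearized ue ?W"
  proof -
    have "of_real \<nu> * A_pow_seq k 1 ?W n + B_seq k a b ?W ue n + B_seq k a b ue ?W n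
      = coord (\<nu> *\<^sub>R diag (cut m (\<lambda>n. (k n)\<^sup>2)) (w t) + B_linearized ue ?W) n" for n
      by (simp add: coord_B_linearized_ue A_pow_seq_one cut_def)
    then show ?thesis unfolding lin_op_def by (simp only: coord_inverse)
  qed
  have D: "D = - (\<nu> *\<^sub>R diag (cut m (\<lambda>n. (k n)\<^sup>2)) (w t) + trunc m (drift (w t)) + ?Q)"
    unfolding D_def L residual_def by (simp add: drift_def algebra_simps)
  have coordD: "coord D n = of_real (k n) * coord (forcing radius (w t)) n
      - of_real (\<nu> * (k n)\<^sup>2) * coord (w t) n" if "n < m" for n
    using that by (simp add: D forcing_def cut_def coord_A_inv_half field_simps)
  have "((\<lambda>s. trunc m (w s)) has_vector_derivative trunc m D) (at t within {0..\<tau>})"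
    using w t by (intro has_vector_derivative_trunc) (simp add: coordD evolves_def)
  also have "trunc m D = D"
    by (rule ell2_eqI) (auto simp: D cut_def)
  finally have W': "((\<lambda>s. trunc m (w s)) has_vector_derivative D) (at t within {0..\<tau>})" .
  show ?thesis
  proof (intro exI[of _ "?W \<bullet> R0 D + D \<bullet> R0 ?W"] conjI)
    show "((\<lambda>s. trunc m (w s) \<bullet> R0 (trunc m (w s))) has_vector_derivative ?W \<bullet> R0 D + D \<bullet> R0 ?W)
        (at t within {0..\<tau>})"
      by (intro bounded_bilinear.has_vector_derivative[OF bounded_bilinear_inner]
        bounded_linear.has_vector_derivative[OF bounded_linear_R0] W')
    have A: "A_pow k (1/2) ?W = diag (cut m k) (w t)"
      unfolding A_pow_def by (subst coord_inverse[symmetric], rule arg_cong[of _ _ Ell2])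
        (auto simp: A_pow_seq_half cut_def fun_eq_iff)
    have inner_le: "- (x \<bullet> R0 ?W) \<le> norm x * (b2 * norm ?W)" for x
      using norm_cauchy_schwarz[of "- x" "R0 ?W"] mult_left_mono[OF norm_R0_le norm_ge_zero, of x ?W] by simp
    have "?W \<bullet> R0 D + D \<bullet> R0 ?W = 2 * (D \<bullet> R0 ?W)"
      using R0_sym[of ?W D] by (simp add: inner_commute)
    also have "\<dots> = - 2 * ((lin_op k \<nu> a b ue ?W + feedback ?W) \<bullet> R0 ?W)
        + 2 * (- (residual m (w t) \<bullet> R0 ?W)) + 2 * (- (?Q \<bullet> R0 ?W))"
      by (simp add: D_def inner_add_left inner_diff_left)
    also have "\<dots> \<le> (- 2 * \<beta> * (?W \<bullet> R0 ?W) - (norm (diag (cut m k) (w t)))\<^sup>2)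
        + 2 * (norm (residual m (w t)) * (b2 * norm (w t))) + 2 * (norm ?Q * (b2 * norm ?W))"
    proof (intro add_mono mult_left_mono inner_le)
      show "- (residual m (w t) \<bullet> R0 ?W) \<le> norm (residual m (w t)) * (b2 * norm (w t))"
        using b12 by (intro order_trans[OF inner_le] mult_left_mono norm_trunc_le) simp_all
    qed (use riccati_dissipation[OF diag_cut_in_dom, of m "\<lambda>_. 1" "w t"] in \<open>simp_all add: A\<close>)
    finally show "?W \<bullet> R0 D + D \<bullet> R0 ?W \<le> - 2 * \<beta> * (?W \<bullet> R0 ?W) - (norm (diag (cut m k) (w t)))\<^sup>2
       + (norm (diag (cut (m + 2) k) (w t)))\<^sup>2 / 2 + 2 * b2 * norm (w t) * norm (residual m (w t))"
      using quadratic_term_le[of m "w t"] by (simp add: mult_ac)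
  qed
qed

abbreviation weighted_V_energy :: "(real \<Rightarrow> ell2) \<Rightarrow> real \<Rightarrow> nat \<Rightarrow> real" where
  "weighted_V_energy w \<tau> m \<equiv> integral {0..\<tau>} (\<lambda>s. exp (2 * \<beta> * s) * (norm (diag (cut m k) (w s)))\<^sup>2)"

lemma truncated_lyapunov_estimate:
  assumes w: "evolves (\<lambda>s. forcing radius (w s)) w \<tau>" and \<tau>: "\<tau> \<ge> 0"
  shows "exp (2 * \<beta> * \<tau>) * (trunc m (w \<tau>) \<bullet> R0 (trunc m (w \<tau>))) + weighted_V_energy w \<tau> m
    \<le> trunc m (w 0) \<bullet> R0 (trunc m (w 0)) + weighted_V_energy w \<tau> (m + 2) / 2
      + integral {0..\<tau>} (\<lambda>s. exp (2 * \<beta> * s) * (2 * b2 * norm (w s) * norm (residual m (w s))))"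
proof -
  define E where "E s = trunc m (w s) \<bullet> R0 (trunc m (w s))" for s
  have cw: "continuous_on {0..\<tau>} w" using w by (simp add: evolves_def)
  have cr: "continuous_on {0..\<tau>} (\<lambda>s. residual m (w s))"
    unfolding residual_def
    by (intro continuous_intros bounded_linear.continuous_on[OF bounded_linear_drift] cw)
  have "\<forall>t\<in>{0..\<tau>}. \<exists>E'. (E has_vector_derivative E') (at t within {0..\<tau>}) \<and>
      E' \<le> - 2 * \<beta> * E t - (norm (diag (cut m k) (w t)))\<^sup>2
       + (norm (diag (cut (m + 2) k) (w t)))\<^sup>2 / 2 + 2 * b2 * norm (w t) * norm (residual m (w t))"
    unfolding E_def by (intro ballI lyapunov_derivative[OF w])
  from bchoice[OF this] obtain E' where
    E': "\<And>t. t \<in> {0..\<tau>} \<Longrightarrow> (E has_vector_derivative E' t) (at t within {0..\<tau>})" and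
    le: "\<And>t. t \<in> {0..\<tau>} \<Longrightarrow> E' t \<le> - 2 * \<beta> * E t - (norm (diag (cut m k) (w t)))\<^sup>2
       + (norm (diag (cut (m + 2) k) (w t)))\<^sup>2 / 2 + 2 * b2 * norm (w t) * norm (residual m (w t))"
    by blast
  have "((\<lambda>s. exp (2 * \<beta> * s) * E s) has_vector_derivative
      exp (2 * \<beta> * t) * E' t + 2 * \<beta> * exp (2 * \<beta> * t) * E t) (at t within {0..\<tau>})" if "t \<in> {0..\<tau>}" for t
  proof -
    have "((\<lambda>s. exp (2 * \<beta> * s)) has_vector_derivative 2 * \<beta> * exp (2 * \<beta> * t)) (at t within {0..\<tau>})"
      unfolding has_real_derivative_iff_has_vector_derivative[symmetric]
      by (auto intro!: derivative_eq_intros)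
    from has_vector_derivative_mult[OF this E'[OF that]] show ?thesis .
  qed
  then have "((\<lambda>t. exp (2 * \<beta> * t) * E' t + 2 * \<beta> * exp (2 * \<beta> * t) * E t) has_integral
      exp (2 * \<beta> * \<tau>) * E \<tau> - exp (2 * \<beta> * 0) * E 0) {0..\<tau>}"
    by (intro fundamental_theorem_of_calculus \<tau>)
  moreover have "((\<lambda>s. exp (2 * \<beta> * s) * (norm (diag (cut (m + 2) k) (w s)))\<^sup>2 / 2
        - exp (2 * \<beta> * s) * (norm (diag (cut m k) (w s)))\<^sup>2
        + exp (2 * \<beta> * s) * (2 * b2 * norm (w s) * norm (residual m (w s)))) has_integral
      weighted_V_energy w \<tau> (m + 2) / 2 - weighted_V_energy w \<tau> m
        + integral {0..\<tau>} (\<lambda>s. exp (2 * \<beta> * s) * (2 * b2 * norm (w s) * norm (residual m (w s))))) {0..\<tau>}"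
    by (intro has_integral_diff has_integral_add has_integral_divide integrable_integral
        integrable_continuous_real continuous_intros cw cr)
  moreover have "exp (2 * \<beta> * t) * E' t + 2 * \<beta> * exp (2 * \<beta> * t) * E t
      \<le> exp (2 * \<beta> * t) * (norm (diag (cut (m + 2) k) (w t)))\<^sup>2 / 2
        - exp (2 * \<beta> * t) * (norm (diag (cut m k) (w t)))\<^sup>2
        + exp (2 * \<beta> * t) * (2 * b2 * norm (w t) * norm (residual m (w t)))" if "t \<in> {0..\<tau>}" for t
    using mult_left_mono[OF le[OF that], of "exp (2 * \<beta> * t)"] by (simp add: algebra_simps)
  ultimately have "exp (2 * \<beta> * \<tau>) * E \<tau> - exp (2 * \<beta> * 0) * E 0
      \<le> weighted_V_energy w \<tau> (m + 2) / 2 - weighted_V_energy w \<tau> m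
        + integral {0..\<tau>} (\<lambda>s. exp (2 * \<beta> * s) * (2 * b2 * norm (w s) * norm (residual m (w s))))"
    by (rule has_integral_le)
  then show ?thesis by (simp add: E_def)
qed

lemma residual_integral_tendsto:
  assumes cw: "continuous_on {0..\<tau>} w"
  shows "(\<lambda>m. integral {0..\<tau>} (\<lambda>s. exp (2 * \<beta> * s) * (2 * b2 * norm (w s) * norm (residual m (w s)))))
    \<longlonglongrightarrow> 0"
proof -
  obtain c where c: "c \<ge> 0" "\<And>m w. norm (residual m w) \<le> c * norm w"
    using residual_bounded by blast
  have "(\<lambda>m. integral {0..\<tau>} (\<lambda>s. exp (2 * \<beta> * s) * (2 * b2 * norm (w s) * norm (residual m (w s)))))
    \<longlonglongrightarrow> integral {0..\<tau>} (\<lambda>s. exp (2 * \<beta> * s) * (2 * b2 * norm (w s) * 0))"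
  proof (rule dominated_convergence(2))
    show "(\<lambda>s. exp (2 * \<beta> * s) * (2 * b2 * norm (w s) * norm (residual m (w s)))) integrable_on {0..\<tau>}" for m
      unfolding residual_def
      by (intro integrable_continuous_real continuous_intros bounded_linear.continuous_on[OF bounded_linear_drift] cw)
    show "(\<lambda>s. exp (2 * \<beta> * s) * (2 * b2 * norm (w s) * (c * norm (w s)))) integrable_on {0..\<tau>}"
      by (intro integrable_continuous_real continuous_intros cw)
    show "norm (exp (2 * \<beta> * s) * (2 * b2 * norm (w s) * norm (residual m (w s))))
        \<le> exp (2 * \<beta> * s) * (2 * b2 * norm (w s) * (c * norm (w s)))" for m s
      using b12 c(2)[of m "w s"] by (simp add: abs_mult mult_left_mono)
    show "(\<lambda>m. exp (2 * \<beta> * s) * (2 * b2 * norm (w s) * norm (residual m (w s))))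
        \<longlonglongrightarrow> exp (2 * \<beta> * s) * (2 * b2 * norm (w s) * 0)" for s
      by (intro tendsto_mult tendsto_const tendsto_norm_zero residual_tendsto)
  qed
  then show ?thesis by simp
qed

text \<open>Up to the initial value and an error that tends to 0, the truncated estimate bounds the energy at
  level \<open>m\<close> by half of the energy at level \<open>m + 2\<close>. The energies at both levels have the same limit, which
  is finite by the energy estimate, so half of it can be subtracted.\<close>

lemma lyapunov_estimate:
  assumes w: "evolves (\<lambda>s. forcing radius (w s)) w \<tau>" and \<tau>: "\<tau> \<ge> 0"
  shows "b1 * exp (2 * \<beta> * \<tau>) * (norm (w \<tau>))\<^sup>2 + weighted_V_energy w \<tau> m / 2 \<le> b2 * (norm (w 0))\<^sup>2"
proof -
  let ?I = "weighted_V_energy w \<tau>"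
  have cw: "continuous_on {0..\<tau>} w" using w by (simp add: evolves_def)
  have cf: "continuous_on {0..\<tau>} (\<lambda>s. forcing radius (w s))"
    by (rule continuous_on_forcing[OF radius_pos cw])
  have int: "(\<lambda>s. exp (2 * \<beta> * s) * (norm (diag (cut m k) (w s)))\<^sup>2) integrable_on {0..\<tau>}" for m
    by (intro integrable_continuous_real continuous_intros cw)
  have inc: "incseq ?I"
    by (intro incseq_SucI integral_le int mult_left_mono power_mono norm_diag_cut_k_mono) simp_all
  define C where "C = exp (2 * \<beta> * \<tau>) * (((norm (w 0))\<^sup>2
      + integral {0..\<tau>} (\<lambda>s. (norm (forcing radius (w s)))\<^sup>2) / \<nu>) / \<nu>)"
  have bound: "?I m \<le> C" for m
  proof -
    have "?I m \<le> integral {0..\<tau>} (\<lambda>s. exp (2 * \<beta> * \<tau>) * (norm (diag (cut m k) (w s)))\<^sup>2)"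
      using \<beta> by (intro integral_le int mult_right_mono integrable_continuous_real continuous_intros cw) simp_all
    also have "\<dots> = exp (2 * \<beta> * \<tau>) * integral {0..\<tau>} (\<lambda>s. (norm (diag (cut m k) (w s)))\<^sup>2)"
      by simp
    also have "\<dots> \<le> C"
      unfolding C_def by (intro mult_left_mono V_energy_bounded w cf \<tau>) simp
    finally show ?thesis .
  qed
  obtain I where I: "?I \<longlonglongrightarrow> I" and I_ge: "\<And>m. ?I m \<le> I"
    using incseq_convergent[OF inc] bound by blast
  have lim: "(\<lambda>m. trunc m u \<bullet> R0 (trunc m u)) \<longlonglongrightarrow> u \<bullet> R0 u" for u
    by (intro tendsto_inner trunc_tendsto bounded_linear.tendsto[OF bounded_linear_R0])
  have "exp (2 * \<beta> * \<tau>) * (w \<tau> \<bullet> R0 (w \<tau>)) + I \<le> w 0 \<bullet> R0 (w 0) + I / 2 + 0"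
  proof (rule LIMSEQ_le)
    show "(\<lambda>m. exp (2 * \<beta> * \<tau>) * (trunc m (w \<tau>) \<bullet> R0 (trunc m (w \<tau>))) + ?I m)
        \<longlonglongrightarrow> exp (2 * \<beta> * \<tau>) * (w \<tau> \<bullet> R0 (w \<tau>)) + I"
      by (intro tendsto_intros lim I)
    show "(\<lambda>m. trunc m (w 0) \<bullet> R0 (trunc m (w 0)) + ?I (m + 2) / 2
        + integral {0..\<tau>} (\<lambda>s. exp (2 * \<beta> * s) * (2 * b2 * norm (w s) * norm (residual m (w s)))))
        \<longlonglongrightarrow> w 0 \<bullet> R0 (w 0) + I / 2 + 0"
      by (intro tendsto_add tendsto_divide lim LIMSEQ_ignore_initial_segment[OF I] tendsto_const
        residual_integral_tendsto cw) simp
  qed (use truncated_lyapunov_estimate[OF w \<tau>] in blast)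
  moreover have "b1 * exp (2 * \<beta> * \<tau>) * (norm (w \<tau>))\<^sup>2 \<le> exp (2 * \<beta> * \<tau>) * (w \<tau> \<bullet> R0 (w \<tau>))"
    using mult_left_mono[OF R0_lower, of "exp (2 * \<beta> * \<tau>)" "w \<tau>"] by (simp add: inner_commute mult_ac)
  moreover have "w 0 \<bullet> R0 (w 0) \<le> b2 * (norm (w 0))\<^sup>2"
    using R0_upper[of "w 0"] by (simp add: inner_commute)
  ultimately show ?thesis using I_ge[of m] by linarith
qed

lemma deviation_decay:
  assumes w: "evolves (\<lambda>s. forcing radius (w s)) w \<tau>" and \<tau>: "\<tau> \<ge> 0"
  shows "norm (w \<tau>) \<le> sqrt (b2 / b1) * exp (- \<beta> * \<tau>) * norm (w 0)"
proof (rule power2_le_imp_le)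
  have "0 \<le> weighted_V_energy w \<tau> 0"
    using w by (intro integral_nonneg integrable_continuous_real continuous_intros)
      (simp_all add: evolves_def)
  then have "b1 * exp (2 * \<beta> * \<tau>) * (norm (w \<tau>))\<^sup>2 \<le> b2 * (norm (w 0))\<^sup>2"
    using lyapunov_estimate[OF assms, of 0] by linarith
  moreover have "exp (2 * \<beta> * \<tau>) = (exp (\<beta> * \<tau>))\<^sup>2" by (simp add: exp_double mult.assoc)
  ultimately have "(norm (w \<tau>))\<^sup>2 \<le> b2 / b1 * (1 / (exp (\<beta> * \<tau>))\<^sup>2) * (norm (w 0))\<^sup>2"
    using b12 by (simp add: field_simps)
  also have "\<dots> = (sqrt (b2 / b1) * exp (- \<beta> * \<tau>) * norm (w 0))\<^sup>2"
    using b12 by (simp add: power_mult_distrib exp_minus power_divide power_inverse divide_inverse)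
  finally show "(norm (w \<tau>))\<^sup>2 \<le> (sqrt (b2 / b1) * exp (- \<beta> * \<tau>) * norm (w 0))\<^sup>2" .
qed (use b12 in simp)

end

section \<open>Weak solutions\<close>

lemma nn_integral_continuous_on_interval:
  fixes g :: "real \<Rightarrow> real"
  assumes g: "continuous_on {a..b} g" and nonneg: "\<And>t. g t \<ge> 0"
  shows "(\<integral>\<^sup>+t\<in>{a..b}. ennreal (g t) \<partial>lebesgue) = ennreal (integral {a..b} g)"
proof -
  have int: "set_integrable lebesgue {a..b} g"
    by (rule absolutely_integrable_continuous_real[OF g])
  have "(\<integral>\<^sup>+t\<in>{a..b}. ennreal (g t) \<partial>lebesgue) = (\<integral>\<^sup>+t. ennreal (indicator {a..b} t *\<^sub>R g t) \<partial>lebesgue)"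
    by (rule nn_integral_cong) (simp split: split_indicator)
  also have "\<dots> = ennreal (LINT t:{a..b}|lebesgue. g t)"
    unfolding set_lebesgue_integral_def using int nonneg
    by (intro nn_integral_eq_integral) (simp_all add: set_integrable_def)
  finally show ?thesis by (simp only: set_lebesgue_integral_eq_integral(2)[OF int])
qed

lemma cinner_unit_vector: "n > 0 \<Longrightarrow> cinner u (unit_vector n) = coord u n"
  unfolding cinner_def by (subst suminf_finite[of "{n}"]) auto

lemma duality_unit_vector: "n > 0 \<Longrightarrow> duality g (unit_vector n) = g n"
  unfolding duality_def by (subst suminf_finite[of "{n}"]) auto

context shell_model
begin

text \<open>Monotone convergence in the truncation level. Finiteness of the limit shows that almost every
  value lies in \<open>V\<close>.\<close>

lemma
  fixes w :: "real \<Rightarrow> ell2" and p :: "real \<Rightarrow> real"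
  assumes w: "continuous_on {0..T} w" and p: "continuous_on {0..T} p" "\<And>t. p t > 0"
    and le: "\<And>m. integral {0..T} (\<lambda>s. p s * (norm (diag (cut m k) (w s)))\<^sup>2) \<le> C"
  shows AE_in_V: "AE t in lebesgue. t \<in> {0..T} \<longrightarrow> w t \<in> V_space k"
    and V_energy_le: "(\<integral>\<^sup>+t\<in>{0..T}. ennreal (p t * (V_norm k (w t))\<^sup>2) \<partial>lebesgue) \<le> ennreal C"
proof -
  define F where "F m t = ennreal (p t * (norm (diag (cut m k) (w t)))\<^sup>2) * indicator {0..T} t" for m t
  have cont: "continuous_on {0..T} (\<lambda>t. p t * (norm (diag (cut m k) (w t)))\<^sup>2)" for m
    by (intro continuous_intros w p)
  have "F m \<in> borel_measurable lebesgue" for m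
  proof -
    have "(\<lambda>t. indicator {0..T} t *\<^sub>R (p t * (norm (diag (cut m k) (w t)))\<^sup>2)) \<in> borel_measurable lebesgue"
      using absolutely_integrable_continuous_real[OF cont]
      by (simp only: set_integrable_def borel_measurable_integrable)
    then have "(\<lambda>t. ennreal (indicator {0..T} t *\<^sub>R (p t * (norm (diag (cut m k) (w t)))\<^sup>2)))
        \<in> borel_measurable lebesgue"
      by measurable
    also have "(\<lambda>t. ennreal (indicator {0..T} t *\<^sub>R (p t * (norm (diag (cut m k) (w t)))\<^sup>2))) = F m"
      unfolding F_def by (rule ext) (simp split: split_indicator)
    finally show ?thesis .
  qed
  moreover have "incseq F"
  proof (intro incseq_SucI le_funI)
    fix m t
    have "(norm (diag (cut m k) (w t)))\<^sup>2 \<le> (norm (diag (cut (Suc m) k) (w t)))\<^sup>2"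
      by (auto simp: norm_diag_cut_square intro!: sum_mono2)
    then show "F m t \<le> F (Suc m) t"
      unfolding F_def by (intro mult_right_mono ennreal_leI mult_left_mono less_imp_le[OF p(2)]) simp_all
  qed
  moreover have F_le: "(\<integral>\<^sup>+t. F m t \<partial>lebesgue) \<le> ennreal C" for m
    unfolding F_def using p(2) le[of m]
    by (subst nn_integral_continuous_on_interval[OF cont]) (simp_all add: less_imp_le ennreal_leI)
  ultimately have sup_le: "(\<integral>\<^sup>+t. (SUP m. F m t) \<partial>lebesgue) \<le> ennreal C"
    by (subst nn_integral_monotone_convergence_SUP) (auto intro: SUP_least)
  moreover have "(\<lambda>t. SUP m. F m t) \<in> borel_measurable lebesgue"
    using \<open>\<And>m. F m \<in> borel_measurable lebesgue\<close> by measurable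
  ultimately have "AE t in lebesgue. (SUP m. F m t) \<noteq> \<infinity>"
    by (intro nn_integral_PInf_AE) (auto simp: top_unique)
  moreover have "w t \<in> V_space k" if fin: "(SUP m. F m t) \<noteq> \<infinity>" and t: "t \<in> {0..T}" for t
  proof -
    obtain c where c: "c \<ge> 0" "(SUP m. F m t) = ennreal c"
      using fin by (cases "SUP m. F m t") auto
    have "norm (diag (cut m k) (w t)) \<le> sqrt (c / p t)" for m
    proof -
      have "F m t \<le> ennreal c" unfolding c(2)[symmetric] by (rule SUP_upper) simp
      then have "p t * (norm (diag (cut m k) (w t)))\<^sup>2 \<le> c"
        using t c(1) by (simp add: F_def)
      then show ?thesis
        using p(2)[of t] by (intro real_le_rsqrt) (simp add: pos_le_divide_eq mult.commute)
    qed
    then show ?thesis by (rule V_spaceI_bounded)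
  qed
  ultimately show AE: "AE t in lebesgue. t \<in> {0..T} \<longrightarrow> w t \<in> V_space k"
    by (auto elim: eventually_mono)
  have "ennreal (p t * (V_norm k (w t))\<^sup>2) \<le> (SUP m. F m t)" if "w t \<in> V_space k" "t \<in> {0..T}" for t
  proof (rule LIMSEQ_le_const2)
    have "(\<lambda>m. (norm (diag (cut m k) (w t)))\<^sup>2) \<longlonglongrightarrow> (V_norm k (w t))\<^sup>2"
      using V_norm_sums[OF that(1)] by (simp add: sums_def norm_diag_cut_square)
    then show "(\<lambda>m. ennreal (p t * (norm (diag (cut m k) (w t)))\<^sup>2)) \<longlonglongrightarrow> ennreal (p t * (V_norm k (w t))\<^sup>2)"
      by (intro tendsto_ennrealI tendsto_mult tendsto_const)
    have "ennreal (p t * (norm (diag (cut m k) (w t)))\<^sup>2) \<le> (SUP m. F m t)" for m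
      using that(2) SUP_upper[of m UNIV "\<lambda>m. F m t"] by (simp add: F_def)
    then show "\<exists>M. \<forall>m\<ge>M. ennreal (p t * (norm (diag (cut m k) (w t)))\<^sup>2) \<le> (SUP m. F m t)"
      by blast
  qed
  then have "AE t in lebesgue. ennreal (p t * (V_norm k (w t))\<^sup>2) * indicator {0..T} t \<le> (SUP m. F m t)"
    using AE by (auto elim!: eventually_mono split: split_indicator)
  then show "(\<integral>\<^sup>+t\<in>{0..T}. ennreal (p t * (V_norm k (w t))\<^sup>2) \<partial>lebesgue) \<le> ennreal C"
    by (rule order_trans[OF nn_integral_mono_AE sup_le])
qed

text \<open>The coordinate equations add up to the tested equation: by the energy estimate the series is
  dominated, so that summation and integration may be exchanged.\<close>

lemma
  fixes h w :: "real \<Rightarrow> ell2"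
  assumes w: "evolves h w \<tau>" and h: "continuous_on {0..\<tau>} h" and \<tau>: "\<tau> \<ge> 0" and v: "v \<in> V_space k"
  defines "g \<equiv> \<lambda>s. duality (\<lambda>n. of_real (k n) * coord (h s) n - of_real (\<nu> * (k n)\<^sup>2) * coord (w s) n) v"
  shows tested_set_integrable: "set_integrable lebesgue {0..\<tau>} g"
    and tested_integral: "(LINT s:{0..\<tau>}|lebesgue. g s) = cinner (w \<tau>) v - cinner (w 0) v"
proof -
  define d where "d n s = of_real (k n) * coord (h s) n - of_real (\<nu> * (k n)\<^sup>2) * coord (w s) n" for n s
  define q where "q n s = (cmod (coord (h s) n))\<^sup>2 + (1 + \<nu>) * ((k n)\<^sup>2 * (cmod (coord v n))\<^sup>2)
      + \<nu> * ((k n)\<^sup>2 * (cmod (coord (w s) n))\<^sup>2)" for n s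
  define F where "F n s = indicator {0..\<tau>} s *\<^sub>R (d n s * cnj (coord v n))" for n s
  have cw: "continuous_on {0..\<tau>} w" using w by (simp add: evolves_def)
  have cd: "continuous_on {0..\<tau>} (\<lambda>s. d n s * cnj (coord v n))" for n
    unfolding d_def by (intro continuous_intros h cw)
  have cq: "continuous_on {0..\<tau>} (q n)" for n
    unfolding q_def by (intro continuous_intros h cw)
  have int: "set_integrable lebesgue {0..\<tau>} (\<lambda>s. d n s * cnj (coord v n))" for n
    by (rule absolutely_integrable_continuous_real[OF cd])
  have intF: "integrable lebesgue (F n)" for n
    using int[of n] unfolding set_integrable_def F_def .
  have q: "cmod (d n s * cnj (coord v n)) \<le> q n s" for n s
  proof -
    have am: "x * y \<le> x\<^sup>2 + y\<^sup>2" if "x \<ge> 0" "y \<ge> 0" for x y :: real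
      using sum_squares_bound[of x y] mult_nonneg_nonneg[OF that] by linarith
    let ?h = "cmod (coord (h s) n)" and ?v = "k n * cmod (coord v n)" and ?w = "k n * cmod (coord (w s) n)"
    have "cmod (d n s) \<le> k n * ?h + \<nu> * (k n)\<^sup>2 * cmod (coord (w s) n)"
      unfolding d_def using \<nu> by (intro order_trans[OF norm_triangle_ineq4]) (simp add: norm_mult norm_power)
    then have "cmod (d n s * cnj (coord v n))
        \<le> (k n * ?h + \<nu> * (k n)\<^sup>2 * cmod (coord (w s) n)) * cmod (coord v n)"
      by (simp add: norm_mult mult_right_mono)
    also have "\<dots> = ?h * ?v + \<nu> * (?w * ?v)" by (simp add: power2_eq_square algebra_simps)
    also have "\<dots> \<le> (?h\<^sup>2 + ?v\<^sup>2) + \<nu> * (?w\<^sup>2 + ?v\<^sup>2)"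
      using \<nu> by (intro add_mono mult_left_mono am) simp_all
    finally show ?thesis by (simp add: q_def power_mult_distrib algebra_simps)
  qed
  define C where "C = ((norm (w 0))\<^sup>2 + integral {0..\<tau>} (\<lambda>s. (norm (h s))\<^sup>2) / \<nu>) / \<nu>"
  note energy = V_energy_bounded[OF w h \<tau>, folded C_def]
  have AE_V: "AE s in lebesgue. s \<in> {0..\<tau>} \<longrightarrow> w s \<in> V_space k"
    using AE_in_V[OF cw continuous_on_const, of 1 C] energy by simp
  have sum_v: "summable (\<lambda>n. (k n)\<^sup>2 * (cmod (coord v n))\<^sup>2)"
    using v by (simp add: V_space_iff)
  have "summable (\<lambda>n. norm (F n s))" if "s \<in> {0..\<tau>} \<longrightarrow> w s \<in> V_space k" for s
  proof (cases "s \<in> {0..\<tau>}")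
    case True
    then have sum_q: "summable (\<lambda>n. q n s)"
      using that unfolding q_def V_space_iff
      by (intro summable_add summable_mult summable_coord_square sum_v) simp
    have "F n s = d n s * cnj (coord v n)" for n
      using True by (simp add: F_def indicator_def)
    then show ?thesis
      by (intro summable_comparison_test'[OF sum_q, of 0]) (simp add: q)
  qed (simp add: F_def)
  then have AE_summable: "AE s in lebesgue. summable (\<lambda>n. norm (F n s))"
    using AE_V by (auto elim!: eventually_mono)
  have norm_F: "(\<integral>s. norm (F n s) \<partial>lebesgue) \<le> integral {0..\<tau>} (q n)" for n
  proof -
    have "(\<integral>s. norm (F n s) \<partial>lebesgue) = (LINT s:{0..\<tau>}|lebesgue. norm (d n s * cnj (coord v n)))"
      unfolding set_lebesgue_integral_def F_def by (rule Bochner_Integration.integral_cong) simp_all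
    also have "\<dots> \<le> (LINT s:{0..\<tau>}|lebesgue. q n s)"
      using set_integrable_norm[OF int] absolutely_integrable_continuous_real[OF cq] q
      by (intro set_integral_mono) simp_all
    also have "\<dots> = integral {0..\<tau>} (q n)"
      by (rule set_lebesgue_integral_eq_integral(2)[OF absolutely_integrable_continuous_real[OF cq]])
    finally show ?thesis .
  qed
  have "summable (\<lambda>n. integral {0..\<tau>} (q n))"
  proof (rule summable_if_partial_sums_le)
    have q_nonneg: "0 \<le> q n s" for n s using \<nu> by (simp add: q_def)
    show "0 \<le> integral {0..\<tau>} (q n)" for n
      by (intro integral_nonneg integrable_continuous_real cq q_nonneg)
    fix m
    have iq: "integral {0..\<tau>} (q n) = integral {0..\<tau>} (\<lambda>s. (cmod (coord (h s) n))\<^sup>2)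
        + \<tau> * (1 + \<nu>) * ((k n)\<^sup>2 * (cmod (coord v n))\<^sup>2)
        + \<nu> * integral {0..\<tau>} (\<lambda>s. (k n)\<^sup>2 * (cmod (coord (w s) n))\<^sup>2)" for n
    proof (rule integral_unique)
      have "((\<lambda>s. (1 + \<nu>) * ((k n)\<^sup>2 * (cmod (coord v n))\<^sup>2)) has_integral
          \<tau> * (1 + \<nu>) * ((k n)\<^sup>2 * (cmod (coord v n))\<^sup>2)) {0..\<tau>}"
        using has_integral_const_real[of "(1 + \<nu>) * ((k n)\<^sup>2 * (cmod (coord v n))\<^sup>2)" 0 \<tau>] \<tau>
        by (simp add: mult.assoc)
      then show "(q n has_integral integral {0..\<tau>} (\<lambda>s. (cmod (coord (h s) n))\<^sup>2)
        + \<tau> * (1 + \<nu>) * ((k n)\<^sup>2 * (cmod (coord v n))\<^sup>2)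
        + \<nu> * integral {0..\<tau>} (\<lambda>s. (k n)\<^sup>2 * (cmod (coord (w s) n))\<^sup>2)) {0..\<tau>}"
        unfolding q_def
        by (intro has_integral_add has_integral_mult_right integrable_integral
          integrable_continuous_real continuous_intros h cw)
    qed
    have "(\<Sum>n<m. integral {0..\<tau>} (\<lambda>s. (k n)\<^sup>2 * (cmod (coord (w s) n))\<^sup>2)) \<le> C"
      using energy[of m] unfolding norm_diag_cut_square
      by (subst (asm) integral_sum) (simp_all add: integrable_continuous_real continuous_intros cw)
    then show "(\<Sum>n<m. integral {0..\<tau>} (q n)) \<le> integral {0..\<tau>} (\<lambda>s. (norm (h s))\<^sup>2)
        + \<tau> * (1 + \<nu>) * (\<Sum>n. (k n)\<^sup>2 * (cmod (coord v n))\<^sup>2) + \<nu> * C"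
      unfolding iq sum.distrib sum_distrib_left[symmetric] using \<nu> \<tau>
      by (intro add_mono mult_left_mono sum_integral_coord_le h sum_le_suminf sum_v) simp_all
  qed
  then have sum_F: "summable (\<lambda>n. \<integral>s. norm (F n s) \<partial>lebesgue)"
    by (rule summable_comparison_test'[of _ 0]) (simp add: norm_F)
  have g: "indicator {0..\<tau>} s *\<^sub>R g s = (\<Sum>n. F n s)" for s
    unfolding g_def F_def d_def duality_def by (simp split: split_indicator)
  show "set_integrable lebesgue {0..\<tau>} g"
    unfolding set_integrable_def g by (rule integrable_suminf[OF intF AE_summable sum_F])
  have "(\<integral>s. F n s \<partial>lebesgue) = coord (w \<tau> - w 0) n * cnj (coord v n)" for n
  proof -
    have "(d n has_integral coord (w \<tau>) n - coord (w 0) n) {0..\<tau>}"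
      unfolding d_def using w \<tau> by (intro fundamental_theorem_of_calculus) (simp_all add: evolves_def)
    from has_integral_mult_left[OF this, of "cnj (coord v n)"]
    have "integral {0..\<tau>} (\<lambda>s. d n s * cnj (coord v n)) = coord (w \<tau> - w 0) n * cnj (coord v n)"
      by (simp only: integral_unique coord_diff)
    then show ?thesis
      using set_lebesgue_integral_eq_integral(2)[OF int, of n]
      unfolding set_lebesgue_integral_def F_def by (simp only:)
  qed
  then show "(LINT s:{0..\<tau>}|lebesgue. g s) = cinner (w \<tau>) v - cinner (w 0) v"
    unfolding set_lebesgue_integral_def g integral_suminf[OF intF AE_summable sum_F]
    using cinner_add_left[of "w \<tau> - w 0" "w 0" v] by (simp add: cinner_def)
qed

end

context riccati_feedback_system
begin

abbreviation solves :: "ell2 \<Rightarrow> real \<Rightarrow> (real \<Rightarrow> ell2) \<Rightarrow> bool" where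
  "solves \<equiv> weak_solution k \<nu> a b (\<lambda>x n. f n - coord (feedback (x - ue)) n)"

lemma solves_continuous:
  assumes "solves u0 T u" "\<tau> < T"
  shows "continuous_on {0..\<tau>} u"
proof -
  have "continuous_on {0..<T} u" using assms(1) unfolding weak_solution_def by blast
  then show ?thesis by (rule continuous_on_subset) (use assms(2) in auto)
qed

text \<open>Testing with a unit vector gives an integrated scalar equation with a continuous integrand, which
  can be differentiated.\<close>

lemma solves_imp_evolves:
  assumes u: "solves u0 T u" and \<tau>: "\<tau> \<in> {0..<T}" and r: "r > 0"
    and le: "\<And>s. s \<in> {0..\<tau>} \<Longrightarrow> norm (u s - ue) \<le> r"
  shows "evolves (\<lambda>s. forcing r (u s - ue)) (\<lambda>s. u s - ue) \<tau>"
  unfolding evolves_def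
proof (intro conjI allI ballI)
  have cu: "continuous_on {0..\<tau>} u"
    using solves_continuous[OF u] \<tau> by simp
  then show "continuous_on {0..\<tau>} (\<lambda>s. u s - ue)" by (intro continuous_intros)
  fix n t assume t: "t \<in> {0..\<tau>}"
  define d where "d s = of_real (k n) * coord (forcing r (u s - ue)) n - of_real (\<nu> * (k n)\<^sup>2) * coord (u s - ue) n" for s
  have cd: "continuous_on {0..\<tau>} d"
    unfolding d_def by (intro continuous_intros continuous_on_forcing r cu)
  show "((\<lambda>s. coord (u s - ue) n) has_vector_derivative
     of_real (k n) * coord (forcing r (u t - ue)) n - of_real (\<nu> * (k n)\<^sup>2) * coord (u t - ue) n)
     (at t within {0..\<tau>})"
  proof (cases "n = 0")
    case False
    define G where "G s = duality (\<lambda>n. f n - coord (feedback (u s - ue)) n - of_real \<nu> * A_pow_seq k 1 (u s) n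
        - B_seq k a b (u s) (u s) n) (unit_vector n)" for s
    have G: "G s = d s" if "s \<in> {0..\<tau>}" for s
      using False coord_forcing[OF r le[OF that], of n] by (simp add: G_def duality_unit_vector d_def)
    have coord_u: "coord (u s) n = coord u0 n + integral {0..s} d" if s: "s \<in> {0..\<tau>}" for s
    proof -
      have "set_integrable lebesgue {0..s} G \<and> cinner (u s) (unit_vector n)
          = cinner u0 (unit_vector n) + (LINT s:{0..s}|lebesgue. G s)"
        using u s \<tau> unit_vector_in_V[of n] unfolding weak_solution_def G_def Let_def by auto
      then have "coord (u s) n = coord u0 n + integral {0..s} G"
        using False set_lebesgue_integral_eq_integral(2)[of "{0..s}" G] by (simp add: cinner_unit_vector)
      also have "integral {0..s} G = integral {0..s} d"
        using s by (intro integral_cong G) auto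
      finally show ?thesis .
    qed
    have "((\<lambda>s. (coord u0 n - coord ue n) + integral {0..s} d) has_vector_derivative 0 + d t) (at t within {0..\<tau>})"
      by (intro has_vector_derivative_add has_vector_derivative_const integral_has_vector_derivative cd t)
    then have "((\<lambda>s. coord (u s - ue) n) has_vector_derivative 0 + d t) (at t within {0..\<tau>})"
      by (rule has_vector_derivative_transform[OF t, rotated]) (simp add: coord_u)
    then show ?thesis by (simp add: d_def)
  qed simp
qed

text \<open>Solutions on a compact interval are bounded, so they solve one and the same equation with a
  clipped nonlinearity.\<close>

lemma solves_unique:
  assumes u: "solves u0 T u" and v: "solves u0 T v" and t: "t \<in> {0..<T}"
  shows "u t = v t"
proof -
  have "\<exists>p. \<forall>s\<in>{0..t}. norm (y s - ue) \<le> p" if "solves u0 T y" for y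
  proof -
    have "continuous_on {0..t} y"
      using solves_continuous[OF that] t by simp
    then have "bounded ((\<lambda>s. norm (y s - ue)) ` {0..t})"
      by (intro compact_imp_bounded compact_continuous_image continuous_intros) simp_all
    then show ?thesis by (auto simp: bounded_real)
  qed
  from this[OF u] this[OF v] obtain p q where
    pq: "\<And>s. s \<in> {0..t} \<Longrightarrow> norm (u s - ue) \<le> p" "\<And>s. s \<in> {0..t} \<Longrightarrow> norm (v s - ue) \<le> q"
    by blast
  define r where "r = max 1 (max p q)"
  have r: "r > 0" by (simp add: r_def)
  obtain \<Lambda> where \<Lambda>: "\<Lambda>-lipschitz_on UNIV (forcing r)" using forcing_lipschitz[OF r] by blast
  have "u t - ue = v t - ue"
  proof (rule semilinear_solution_unique[OF \<Lambda>])
    show "evolves (\<lambda>s. forcing r (u s - ue)) (\<lambda>s. u s - ue) t"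
      using pq by (intro solves_imp_evolves[OF u t r]) (simp add: r_def le_max_iff_disj)
    show "evolves (\<lambda>s. forcing r (v s - ue)) (\<lambda>s. v s - ue) t"
      using pq by (intro solves_imp_evolves[OF v t r]) (simp add: r_def le_max_iff_disj)
    show "u 0 - ue = v 0 - ue" using u v by (simp add: weak_solution_def)
  qed (use t in simp)
  then show ?thesis by simp
qed

lemma evolves_imp_solves:
  assumes w: "\<And>\<tau>. \<tau> \<ge> 0 \<Longrightarrow> evolves (\<lambda>s. forcing r (w s)) w \<tau>"
    and r: "r > 0" and le: "\<And>s. s \<ge> 0 \<Longrightarrow> norm (w s) \<le> r" and T: "T > 0"
  shows "solves (ue + w 0) T (\<lambda>t. ue + w t)"
  unfolding weak_solution_def Let_def
proof (intro conjI ballI)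
  have cw: "continuous_on {0..\<tau>} w" if "\<tau> \<ge> 0" for \<tau> using w[OF that] by (simp add: evolves_def)
  have cT: "continuous_on {0..T} (\<lambda>t. ue + w t)" using T by (intro continuous_intros cw) simp
  have ch: "continuous_on {0..\<tau>} (\<lambda>s. forcing r (w s))" if "\<tau> \<ge> 0" for \<tau>
    by (rule continuous_on_forcing[OF r cw[OF that]])
  show "continuous_on {0..<T} (\<lambda>t. ue + w t)"
    by (rule continuous_on_subset[OF cT]) auto
  define C where "C = ((norm (w 0))\<^sup>2 + integral {0..T} (\<lambda>s. (norm (forcing r (w s)))\<^sup>2) / \<nu>) / \<nu>"
  have C: "integral {0..T} (\<lambda>s. (norm (diag (cut m k) (w s)))\<^sup>2) \<le> C" for m
    unfolding C_def using T by (intro V_energy_bounded w ch) simp_all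
  have energy: "integral {0..T} (\<lambda>s. 1 * (norm (diag (cut m k) (ue + w s)))\<^sup>2) \<le> 2 * T * (V_norm k ue)\<^sup>2 + 2 * C" for m
  proof -
    have ue_le: "(norm (diag (cut m k) ue))\<^sup>2 \<le> (V_norm k ue)\<^sup>2"
      unfolding norm_diag_cut_square using V_norm_sums[OF ue]
      sum_le_suminf[of "\<lambda>n. (k n)\<^sup>2 * (cmod (coord ue n))\<^sup>2" "{..<m}"] by (simp add: sums_iff)
    have "(norm (diag (cut m k) (ue + w s)))\<^sup>2
        \<le> 2 * (V_norm k ue)\<^sup>2 + 2 * (norm (diag (cut m k) (w s)))\<^sup>2" for s
    proof -
      have "diag (cut m k) (ue + w s) = diag (cut m k) ue + diag (cut m k) (w s)"
        by (rule linear_add[OF bounded_linear.linear[OF bounded_linear_diag_cut]])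
      then have "(norm (diag (cut m k) (ue + w s)))\<^sup>2
          \<le> (norm (diag (cut m k) ue) + norm (diag (cut m k) (w s)))\<^sup>2"
        by (simp add: power_mono norm_triangle_ineq)
      also have "\<dots> \<le> 2 * (norm (diag (cut m k) ue))\<^sup>2 + 2 * (norm (diag (cut m k) (w s)))\<^sup>2"
        using sum_squares_bound[of "norm (diag (cut m k) ue)" "norm (diag (cut m k) (w s))"]
        by (simp add: power2_sum)
      finally show ?thesis using ue_le by simp
    qed
    then have "integral {0..T} (\<lambda>s. 1 * (norm (diag (cut m k) (ue + w s)))\<^sup>2)
        \<le> integral {0..T} (\<lambda>s. 2 * (V_norm k ue)\<^sup>2 + 2 * (norm (diag (cut m k) (w s)))\<^sup>2)"
      using T by (intro integral_le integrable_continuous_real continuous_intros cw) simp_all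
    also have "\<dots> = T * (2 * (V_norm k ue)\<^sup>2) + 2 * integral {0..T} (\<lambda>s. (norm (diag (cut m k) (w s)))\<^sup>2)"
      using T by (subst integral_add) (auto intro!: integrable_continuous_real continuous_intros cw)
    also have "\<dots> \<le> 2 * T * (V_norm k ue)\<^sup>2 + 2 * C" using C[of m] by simp
    finally show ?thesis .
  qed
  show "AE t in lebesgue. t \<in> {0<..<T} \<longrightarrow> ue + w t \<in> V_space k"
    using AE_in_V[OF cT continuous_on_const _ energy] by (auto elim: eventually_mono)
  have "(\<integral>\<^sup>+t\<in>{0<..<T}. ennreal ((V_norm k (ue + w t))\<^sup>2) \<partial>lebesgue)
      \<le> (\<integral>\<^sup>+t\<in>{0..T}. ennreal (1 * (V_norm k (ue + w t))\<^sup>2) \<partial>lebesgue)"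
    by (intro nn_integral_mono) (auto split: split_indicator)
  also have "\<dots> \<le> ennreal (2 * T * (V_norm k ue)\<^sup>2 + 2 * C)"
    by (rule V_energy_le[OF cT continuous_on_const _ energy]) simp
  finally show "(\<integral>\<^sup>+t\<in>{0<..<T}. ennreal ((V_norm k (ue + w t))\<^sup>2) \<partial>lebesgue) < \<infinity>"
    by (auto simp: less_top[symmetric] top_unique)
  fix v t assume v: "v \<in> V_space k" and t: "t \<in> {0..<T}"
  then have t0: "t \<ge> 0" by simp
  let ?g = "\<lambda>s. duality (\<lambda>n. f n - coord (feedback (ue + w s - ue)) n
      - of_real \<nu> * A_pow_seq k 1 (ue + w s) n - B_seq k a b (ue + w s) (ue + w s) n) v"
  let ?d = "\<lambda>s. duality (\<lambda>n. of_real (k n) * coord (forcing r (w s)) n - of_real (\<nu> * (k n)\<^sup>2) * coord (w s) n) v"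
  have eq: "?g s = ?d s" if "s \<in> {0..t}" for s
    using coord_forcing[OF r le, of s] that by simp
  note d = tested_set_integrable[OF w[OF t0] ch[OF t0] t0 v] tested_integral[OF w[OF t0] ch[OF t0] t0 v]
  have "set_integrable lebesgue {0..t} ?g = set_integrable lebesgue {0..t} ?d"
    by (rule set_integrable_cong[OF refl refl]) (rule eq)
  then show "set_integrable lebesgue {0..t} ?g"
    using d(1) by (simp only: simp_thms)
  have "(LINT s:{0..t}|lebesgue. ?g s) = (LINT s:{0..t}|lebesgue. ?d s)"
    by (rule set_lebesgue_integral_cong) (simp, intro allI impI eq)
  then show "cinner (ue + w t) v = cinner (ue + w 0) v + (LINT s:{0..t}|lebesgue. ?g s)"
    using d(2) by (simp add: cinner_add_left)
qed simp

text \<open>A solution may grow to \<open>sqrt (b2 / b1)\<close> times its initial norm before it decays, and it must not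
  leave the ball in which the clipping is inactive.\<close>

definition basin :: real where
  "basin = radius / sqrt (b2 / b1)"

lemma basin_pos: "basin > 0"
  using radius_pos b12 by (simp add: basin_def)

lemma stabilized_solution_exists:
  assumes u0: "u0 \<in> ball ue basin"
  shows "\<exists>u. \<forall>T>0. solves u0 T u
    \<and> (\<forall>t\<in>{0..<T}. norm (u t - ue) \<le> sqrt (b2 / b1) * exp (- \<beta> * t) * norm (u0 - ue))
    \<and> (\<integral>\<^sup>+t\<in>{0<..<T}. ennreal (exp (2 * \<beta> * t) * (norm (A_pow k (1/2) (u t - ue)))\<^sup>2) \<partial>lebesgue)
       \<le> ennreal (2 * b2 * (norm (u0 - ue))\<^sup>2)"
proof -
  obtain \<Lambda> where "\<Lambda>-lipschitz_on UNIV (forcing radius)" using forcing_lipschitz[OF radius_pos] by blast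
  from semilinear_solution_exists[OF this, of "u0 - ue"] obtain w where
    w0: "w 0 = u0 - ue" and w: "\<And>\<tau>. \<tau> \<ge> 0 \<Longrightarrow> evolves (\<lambda>s. forcing radius (w s)) w \<tau>"
    by blast
  have decay: "norm (w t) \<le> sqrt (b2 / b1) * exp (- \<beta> * t) * norm (u0 - ue)" if "t \<ge> 0" for t
    using deviation_decay[OF w[OF that] that] by (simp add: w0)
  have le: "norm (w t) \<le> radius" if "t \<ge> 0" for t
  proof -
    have "norm (w t) \<le> sqrt (b2 / b1) * 1 * basin"
      using u0 \<beta> that b12
      by (intro order_trans[OF decay[OF that]] mult_mono) (simp_all add: dist_norm norm_minus_commute)
    also have "\<dots> = radius" using b12 by (simp add: basin_def)
    finally show ?thesis .
  qed
  have "solves u0 T (\<lambda>t. ue + w t)" if "T > 0" for T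
    using evolves_imp_solves[OF w radius_pos le that] by (simp add: w0)
  moreover have "(\<integral>\<^sup>+t\<in>{0<..<T}. ennreal (exp (2 * \<beta> * t) * (norm (A_pow k (1/2) (w t)))\<^sup>2) \<partial>lebesgue)
       \<le> ennreal (2 * b2 * (norm (u0 - ue))\<^sup>2)" if T: "T > 0" for T
  proof -
    have "weighted_V_energy w T m \<le> 2 * b2 * (norm (u0 - ue))\<^sup>2" for m
    proof -
      have "0 \<le> b1 * exp (2 * \<beta> * T) * (norm (w T))\<^sup>2" using b12 by simp
      then show ?thesis using lyapunov_estimate[OF w, of T m] T by (simp add: w0)
    qed
    moreover have "continuous_on {0..T} w" using w[of T] T by (simp add: evolves_def)
    ultimately have "(\<integral>\<^sup>+t\<in>{0..T}. ennreal (exp (2 * \<beta> * t) * (V_norm k (w t))\<^sup>2) \<partial>lebesgue)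
        \<le> ennreal (2 * b2 * (norm (u0 - ue))\<^sup>2)"
      by (intro V_energy_le continuous_intros) simp_all
    then show ?thesis
      unfolding V_norm_def
      by (rule order_trans[rotated]) (intro nn_integral_mono, auto split: split_indicator)
  qed
  ultimately show ?thesis
    using decay by (intro exI[of _ "\<lambda>t. ue + w t"]) simp
qed

lemma solves_decay:
  assumes u0: "u0 \<in> ball ue basin" and u: "solves u0 T u" and T: "T > 0"
  shows "\<And>t. t \<in> {0..<T} \<Longrightarrow> norm (u t - ue) \<le> sqrt (b2 / b1) * exp (- \<beta> * t) * norm (u0 - ue)"
    and "(\<integral>\<^sup>+t\<in>{0<..<T}. ennreal (exp (2 * \<beta> * t) * (norm (A_pow k (1/2) (u t - ue)))\<^sup>2) \<partial>lebesgue)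
       \<le> ennreal (2 * b2 * (norm (u0 - ue))\<^sup>2)"
proof -
  obtain y where y: "solves u0 T y"
    "\<forall>t\<in>{0..<T}. norm (y t - ue) \<le> sqrt (b2 / b1) * exp (- \<beta> * t) * norm (u0 - ue)"
    "(\<integral>\<^sup>+t\<in>{0<..<T}. ennreal (exp (2 * \<beta> * t) * (norm (A_pow k (1/2) (y t - ue)))\<^sup>2) \<partial>lebesgue)
       \<le> ennreal (2 * b2 * (norm (u0 - ue))\<^sup>2)"
    using stabilized_solution_exists[OF u0] T by blast
  have eq: "u t = y t" if "t \<in> {0..<T}" for t by (rule solves_unique[OF u y(1) that])
  show "norm (u t - ue) \<le> sqrt (b2 / b1) * exp (- \<beta> * t) * norm (u0 - ue)" if "t \<in> {0..<T}" for t
    using y(2) that eq[OF that] by simp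
  have "(\<integral>\<^sup>+t\<in>{0<..<T}. ennreal (exp (2 * \<beta> * t) * (norm (A_pow k (1/2) (u t - ue)))\<^sup>2) \<partial>lebesgue)
      = (\<integral>\<^sup>+t\<in>{0<..<T}. ennreal (exp (2 * \<beta> * t) * (norm (A_pow k (1/2) (y t - ue)))\<^sup>2) \<partial>lebesgue)"
    by (rule nn_integral_cong) (simp add: eq split: split_indicator)
  then show "(\<integral>\<^sup>+t\<in>{0<..<T}. ennreal (exp (2 * \<beta> * t) * (norm (A_pow k (1/2) (u t - ue)))\<^sup>2) \<partial>lebesgue)
       \<le> ennreal (2 * b2 * (norm (u0 - ue))\<^sup>2)"
    using y(3) by simp
qed

end

section \<open>Exponential stabilization\<close>

theorem theorem3p9:
  fixes k0 lam \<nu> a b c \<beta> b1 b2 :: real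
    and k :: "nat \<Rightarrow> real"
    and f :: "nat \<Rightarrow> complex"
    and ue :: ell2
    and L B1 R0 :: "ell2 \<Rightarrow> ell2"
    and DR :: "ell2 set"
    and ev :: "nat \<Rightarrow> complex"
    and \<phi> \<phi>s :: "nat \<Rightarrow> ell2"
    and N :: nat
  assumes lam: "lam > 1" and k0: "k0 > 0" and k: "\<And>n. k n = k0 * lam ^ n"
    and \<nu>: "\<nu> > 0" and abc: "a + b + c = 0"
    and f: "f \<in> V_dual k"
    and ue: "ue \<in> V_space k"
    and steady: "\<And>n. of_real \<nu> * A_pow_seq k 1 ue n + B_seq k a b ue ue n = f n"
    and L: "L = lin_op k \<nu> a b ue"
    and B1: "bounded_linear B1" "\<And>z u. B1 (z *\<^sub>C u) = z *\<^sub>C B1 u"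
    and spectrum: "op_spectrum (dom_A_pow k 1) L = ev ` {1..}"
    and distinct: "inj_on ev {1..}"
    and semisimple: "\<And>j. j \<ge> 1 \<Longrightarrow> semisimple_eigenvalue (dom_A_pow k 1) L (ev j)"
    and eigvec: "\<And>j. j \<ge> 1 \<Longrightarrow> \<phi> j \<in> dom_A_pow k 1 \<and> L (\<phi> j) = ev j *\<^sub>C \<phi> j"
    and eigvec_adj: "\<And>j. j \<ge> 1 \<Longrightarrow> adjoint_at (dom_A_pow k 1) L (\<phi>s j) (cnj (ev j) *\<^sub>C \<phi>s j)"
    and biorth: "\<And>i j. i \<ge> 1 \<Longrightarrow> j \<ge> 1 \<Longrightarrow> cinner (\<phi> j) (\<phi>s i) = (if i = j then 1 else 0)"
    and \<beta>: "\<beta> > 0"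
    and ordered: "\<And>i j. 1 \<le> i \<Longrightarrow> i \<le> j \<Longrightarrow> Re (ev i) \<le> Re (ev j)"
    and N: "\<And>j. 1 \<le> j \<Longrightarrow> j \<le> N \<Longrightarrow> Re (ev j) < \<beta>" "\<And>j. j > N \<Longrightarrow> \<beta> < Re (ev j)"
    and R0_sa: "self_adjoint_operator DR R0"
    and R0_nonneg: "\<And>u. u \<in> DR \<Longrightarrow> 0 \<le> R0 u \<bullet> u"
    and b12: "b1 > 0" "b2 > 0"
    and R0_bounds: "\<And>u. u \<in> DR \<and> b1 * (norm u)\<^sup>2 \<le> R0 u \<bullet> u \<and> R0 u \<bullet> u \<le> b2 * (norm u)\<^sup>2"
    and R0_V: "\<exists>C. \<forall>u\<in>V_space k. norm (R0 u) \<le> C * V_norm k u"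
    and riccati: "riccati_equation k L \<beta> N B1 \<phi>s R0"
  shows "(\<exists>\<rho>>0. exponentially_stabilizes k \<nu> a b f B1 (riccati_feedback N B1 \<phi>s R0 ue) ue \<rho>) \<and>
    (\<exists>\<rho>0>0. \<forall>\<rho>. 0 < \<rho> \<and> \<rho> \<le> \<rho>0 \<longrightarrow>
      (\<exists>C>0. \<forall>u0\<in>ball ue \<rho>. \<forall>T>0.
        let solves = weak_solution k \<nu> a b (\<lambda>x n. f n - coord (closed_loop_term N B1 \<phi>s R0 ue x) n) u0 T
        in (\<exists>u. solves u) \<and>
           (\<forall>u v. solves u \<and> solves v \<longrightarrow> (\<forall>t\<in>{0..<T}. u t = v t)) \<and>
           (\<forall>u. solves u \<longrightarrow>
              (\<integral>\<^sup>+t\<in>{0<..<T}. ennreal (exp (2 * \<beta> * t) * (norm (A_pow k (1/2) (u t - ue)))\<^sup>2) \<partial>lebesgue)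
                 \<le> ennreal (C * (norm (u0 - ue))\<^sup>2) \<and>
              (\<forall>t\<in>{0..<T}. norm (u t - ue) \<le> C * exp (- \<beta> * t) * norm (u0 - ue)))))"
proof -
  have DR: "DR = UNIV" using R0_bounds by blast
  interpret riccati_feedback_system k0 lam \<nu> a b k \<beta> b1 b2 f ue R0 B1 \<phi>s N
  proof (intro riccati_feedback_system.intro shell_model.intro riccati_feedback_system_axioms.intro)
    show "linear R0"
      using R0_sa unfolding self_adjoint_operator_def DR by (intro linearI) simp_all
    show "R0 u \<bullet> v = u \<bullet> R0 v" for u v
      using R0_sa unfolding self_adjoint_operator_def adjoint_at_def DR by blast
    show "riccati_equation k (lin_op k \<nu> a b ue) \<beta> N B1 \<phi>s R0"
      using riccati unfolding L .
  qed (use lam k0 k \<nu> \<beta> b12 ue steady R0_bounds in blast)+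
  note linear_B1 = bounded_linear.linear[OF B1(1)]
  have closed_loop: "closed_loop_term N B1 \<phi>s R0 ue x = feedback (x - ue)" for x
    by (simp add: closed_loop_term_def feedback_def)
  have controlled: "(\<lambda>x n. f n + coord (B1 (riccati_feedback N B1 \<phi>s R0 ue x)) n)
      = (\<lambda>x n. f n - coord (feedback (x - ue)) n)"
    by (simp add: riccati_feedback_def feedback_def linear_neg[OF linear_B1] linear_sum[OF linear_B1] B1(2))
  define C where "C = max (sqrt (b2 / b1)) (2 * b2)"
  have C: "C > 0" "sqrt (b2 / b1) \<le> C" "2 * b2 \<le> C"
    using b12 by (auto simp: C_def)
  have decay: "norm (u t - ue) \<le> C * exp (- \<beta> * t) * norm (u0 - ue)"
    if "u0 \<in> ball ue basin" "solves u0 T u" "T > 0" "t \<in> {0..<T}" for u0 u T t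
    by (rule order_trans[OF solves_decay(1)[OF that]]) (intro mult_right_mono C, simp_all)
  have energy: "(\<integral>\<^sup>+t\<in>{0<..<T}. ennreal (exp (2 * \<beta> * t) * (norm (A_pow k (1/2) (u t - ue)))\<^sup>2) \<partial>lebesgue)
      \<le> ennreal (C * (norm (u0 - ue))\<^sup>2)"
    if "u0 \<in> ball ue basin" "solves u0 T u" "T > 0" for u0 u T
    by (rule order_trans[OF solves_decay(2)[OF that]]) (intro ennreal_leI mult_right_mono C, simp)
  have "exponentially_stabilizes k \<nu> a b f B1 (riccati_feedback N B1 \<phi>s R0 ue) ue basin"
    unfolding exponentially_stabilizes_def Let_def controlled
  proof (rule exI[of _ C], rule conjI[OF C(1)], rule exI[of _ \<beta>], rule conjI[OF \<beta>],
      intro ballI conjI allI impI)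
    fix u0 assume u0: "u0 \<in> ball ue basin"
    show "\<exists>u. \<forall>T>0. solves u0 T u"
      using stabilized_solution_exists[OF u0] by blast
  qed (rule decay, assumption+)
  moreover have "\<exists>C>0. \<forall>u0\<in>ball ue \<rho>. \<forall>T>0.
      (\<exists>u. solves u0 T u) \<and>
      (\<forall>u v. solves u0 T u \<and> solves u0 T v \<longrightarrow> (\<forall>t\<in>{0..<T}. u t = v t)) \<and>
      (\<forall>u. solves u0 T u \<longrightarrow>
        (\<integral>\<^sup>+t\<in>{0<..<T}. ennreal (exp (2 * \<beta> * t) * (norm (A_pow k (1/2) (u t - ue)))\<^sup>2) \<partial>lebesgue)
           \<le> ennreal (C * (norm (u0 - ue))\<^sup>2) \<and>
        (\<forall>t\<in>{0..<T}. norm (u t - ue) \<le> C * exp (- \<beta> * t) * norm (u0 - ue)))"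
    if "\<rho> \<le> basin" for \<rho>
  proof (intro exI[of _ C] ballI allI impI conjI C(1))
    fix u0 T assume "u0 \<in> ball ue \<rho>" and T: "(T::real) > 0"
    then have u0: "u0 \<in> ball ue basin" using that by auto
    show "\<exists>u. solves u0 T u" using stabilized_solution_exists[OF u0] T by blast
    show "u t = v t" if "solves u0 T u \<and> solves u0 T v" "t \<in> {0..<T}" for u v t
      using solves_unique that by blast
    fix u assume u: "solves u0 T u"
    show "(\<integral>\<^sup>+t\<in>{0<..<T}. ennreal (exp (2 * \<beta> * t) * (norm (A_pow k (1/2) (u t - ue)))\<^sup>2) \<partial>lebesgue)
        \<le> ennreal (C * (norm (u0 - ue))\<^sup>2)"
      by (rule energy[OF u0 u T])
    show "norm (u t - ue) \<le> C * exp (- \<beta> * t) * norm (u0 - ue)" if "t \<in> {0..<T}" for t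
      by (rule decay[OF u0 u T that])
  qed
  ultimately show ?thesis
    unfolding closed_loop Let_def using basin_pos by blast
qed

end
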